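(* Let $\Delta$ be a locally compact Hausdorff space with countable base, $\{a_n\}$ positive with $a_n\to\infty$, and $\{\xi^n\}_{n\in\mathbb{N}}$ an $\mathcal{M}(\Delta)$-valued process. Assume that for all $m\in\mathbb{N}$ and $f_1,\dots,f_m\in C_c(\Delta)$, the $\mathbb{R}^m$-valued process $\{(\xi^nf_1,\dots,\xi^nf_m)\}_n$ satisfies an LDP with speed $a_n$ and good rate function $I_{f_1,\dots,f_m}$. Then $\{\xi^n\}$ satisfies the LDP in $\mathcal{M}(\Delta)$ with speed $a_n$ and good rate function \[ I(\xi)=\sup_{m\in\mathbb{N}}\sup_{f_1,\dots,f_m\in C_c(\Delta)}I_{f_1,\dots,f_m}(\xi f_1,\dots,\xi f_m). \] Moreover: (1) if $I_f$ has a unique zero for every $f\in C_c(\Delta)$, then $I$ has a unique zero; (2) if every $I_{f_1,\dots,f_m}$ is convex and $\sup_n a_n^{-1}\log\mathbb{E}[\exp(a_n\xi^nf)]<\infty$ for every $f\in C_c(\Delta)$, then for every $f\in C_c(\Delta)$ the limit $\varphi(f)=\lim_{n\to\infty}a_n^{-1}\log\mathbb{E}[\exp(a_n\xi^nf)]$ exists in $\mathbb{R}$ and $I(\xi)=\sup_{f\in C_c(\Delta)}\{\xi f-\varphi(f)\}$ for all $\xi\in\mathcal{M}(\Delta)$.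
   Context: $C_c(\Delta)$: real continuous compactly supported functions on $\Delta$. $\mathcal{M}(\Delta)$: Radon measures on $\Delta$ (Borel measures finite on compact sets), with the vague topology, i.e. the weakest topology making $\xi\mapsto\xi f:=\int_\Delta f\,d\xi$ continuous for every $f\in C_c(\Delta)$. LDP with speed $a_n$ and rate function $I$ (lower semicontinuous, $[0,\infty]$-valued): $\limsup a_n^{-1}\log P(\xi^n\in F)\le-\inf_F I$ for closed $F$ and $\liminf a_n^{-1}\log P(\xi^n\in G)\ge-\inf_G I$ for open $G$; good means all sublevel sets $\{I\le\alpha\}$ are compact. *)

theory Defs
  imports "HOL-Analysis.Analysis" "HOL-Probability.Probability"
begin

definition Cc :: "('a::topological_space \<Rightarrow> real) set" where
  "Cc = {f. continuous_on UNIV f \<and> compact (closure {x. f x \<noteq> 0})}"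

definition radon_measures :: "'a::topological_space measure set" where
  "radon_measures = {\<mu>. sets \<mu> = sets borel \<and> (\<forall>K. compact K \<longrightarrow> emeasure \<mu> K < \<infinity>)}"

definition vague_topology :: "'a::topological_space measure topology" where
  "vague_topology = topology_generated_by
     {{\<mu> \<in> radon_measures. integral\<^sup>L \<mu> f \<in> U} | f U. f \<in> Cc \<and> open U}"

definition borel_of_top :: "'b topology \<Rightarrow> 'b measure" where
  "borel_of_top X = sigma (topspace X) {U. openin X U}"

text \<open>Euclidean space R^m as functions on \<open>{..<m}\<close> (extensional), product topology.\<close>
abbreviation Rm_topology :: "nat \<Rightarrow> (nat \<Rightarrow> real) topology" where
  "Rm_topology m \<equiv> product_topology (\<lambda>_. euclideanreal) {..<m}"

definition fdvec :: "nat \<Rightarrow> (nat \<Rightarrow> 'a \<Rightarrow> real) \<Rightarrow> 'a measure \<Rightarrow> (nat \<Rightarrow> real)" where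
  "fdvec m fs \<mu> = restrict (\<lambda>i. integral\<^sup>L \<mu> (fs i)) {..<m}"

definition eln :: "ennreal \<Rightarrow> ereal" where
  "eln x = (if x = 0 then -\<infinity> else if x = \<top> then \<infinity> else ereal (ln (enn2real x)))"

definition rate_function :: "'b topology \<Rightarrow> ('b \<Rightarrow> ereal) \<Rightarrow> bool" where
  "rate_function X I \<longleftrightarrow> (\<forall>x\<in>topspace X. 0 \<le> I x) \<and>
     (\<forall>c::ereal. closedin X {x \<in> topspace X. I x \<le> c})"

definition good_rate_function :: "'b topology \<Rightarrow> ('b \<Rightarrow> ereal) \<Rightarrow> bool" where
  "good_rate_function X I \<longleftrightarrow> rate_function X I \<and>
     (\<forall>c::real. compactin X {x \<in> topspace X. I x \<le> ereal c})"

definition pr :: "(nat \<Rightarrow> 'w measure) \<Rightarrow> (nat \<Rightarrow> 'w \<Rightarrow> 'b) \<Rightarrow> nat \<Rightarrow> 'b set \<Rightarrow> ennreal" where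
  "pr M Z n A = emeasure (M n) {\<omega> \<in> space (M n). Z n \<omega> \<in> A}"

definition ldp :: "'b topology \<Rightarrow> (nat \<Rightarrow> 'w measure) \<Rightarrow> (nat \<Rightarrow> 'w \<Rightarrow> 'b) \<Rightarrow>
    (nat \<Rightarrow> real) \<Rightarrow> ('b \<Rightarrow> ereal) \<Rightarrow> bool" where
  "ldp X M Z a I \<longleftrightarrow> rate_function X I \<and>
     (\<forall>F. closedin X F \<longrightarrow>
        limsup (\<lambda>n. ereal (1 / a n) * eln (pr M Z n F)) \<le> - (INF x\<in>F. I x)) \<and>
     (\<forall>G. openin X G \<longrightarrow>
        liminf (\<lambda>n. ereal (1 / a n) * eln (pr M Z n G)) \<ge> - (INF x\<in>G. I x))"

definition convex_Rm :: "nat \<Rightarrow> ((nat \<Rightarrow> real) \<Rightarrow> ereal) \<Rightarrow> bool" where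
  "convex_Rm m J \<longleftrightarrow> (\<forall>x\<in>topspace (Rm_topology m). \<forall>y\<in>topspace (Rm_topology m).
     \<forall>t::real. 0 \<le> t \<and> t \<le> 1 \<longrightarrow>
       J (restrict (\<lambda>i. t * x i + (1 - t) * y i) {..<m}) \<le> ereal t * J x + ereal (1 - t) * J y)"

definition scaled_lmgf :: "(nat \<Rightarrow> 'w measure) \<Rightarrow> (nat \<Rightarrow> 'w \<Rightarrow> 'a measure) \<Rightarrow>
    (nat \<Rightarrow> real) \<Rightarrow> ('a \<Rightarrow> real) \<Rightarrow> nat \<Rightarrow> ereal" where
  "scaled_lmgf M \<xi> a f n = ereal (1 / a n) *
     eln (\<integral>\<^sup>+ \<omega>. ennreal (exp (a n * integral\<^sup>L (\<xi> n \<omega>) f)) \<partial>M n)"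

end

theory Submission
  imports Defs
begin

text \<open>
  Evaluation at test functions embeds the Radon measures with the vague topology into the product
  \<open>\<real>\<^bsup>Cc\<^esup>\<close>, and by the Riesz representation theorem the image is the closed set of positive linear
  functionals. Level sets of \<open>I\<close> therefore sit in a Tychonoff box, which gives goodness, and if a
  closed set misses \<open>{I \<le> c}\<close>, compactness of that box already separates the two in finitely many
  coordinates; the upper bound is then the finite-dimensional one. The lower bound is immediate because
  basic vague neighbourhoods are finite-dimensional. Riesz' measure comes from the outer measure
  \<open>inf {\<Sum>\<^sub>n \<Lambda> g\<^sub>n | g\<^sub>n \<ge> 0, \<Sum>\<^sub>n g\<^sub>n \<ge> 1 on A}\<close>, whose countable subadditivity is automatic.

  For the variational formula, Varadhan's lemma identifies \<open>\<phi> (\<Sum>\<^sub>i l\<^sub>i f\<^sub>i)\<close> with the convex conjugate of the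
  finite-dimensional rate function at \<open>l\<close>, and biconjugation recovers the rate function.
\<close>

section \<open>Compactly supported functions\<close>

text \<open>The hypotheses do not relate the rate functions \<open>J m fs\<close> of different
  tuples to each other. The relation that is needed, that selecting coordinates cannot increase the
  rate, is extracted from the LDPs themselves by contraction. Because of it, a point found for one
  large tuple is admissible for all its subtuples, which is the finite intersection property behind
  the upper bound. A limit point in the product is a priori just a function on \<open>Cc\<close>;
  the Riesz theorem is what turns it back into a measure. Covers by sequences of functions
  concatenate freely. The price is paid elsewhere: lower bounds for the outer measure require Dini's
  argument, and measurability is checked by splitting a cover along \<open>{f > 0}\<close>. Second
  countability makes these sets generate the Borel sets. Varadhan's upper bound needs an exponential
  moment beyond the one being computed; it is available because \<open>Cc\<close> is closed under
  scaling, so the moment hypothesis also holds for \<open>2 f\<close>.\<close>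

lemma Cc_continuous: "f \<in> Cc \<Longrightarrow> continuous_on UNIV f"
  by (simp add: Cc_def)

lemma Cc_borel: "f \<in> Cc \<Longrightarrow> f \<in> borel_measurable borel"
  by (simp add: Cc_continuous borel_measurable_continuous_onI)

lemma Cc_support:
  assumes "f \<in> Cc"
  obtains K where "compact K" "\<And>x. x \<notin> K \<Longrightarrow> f x = 0"
proof
  show "compact (closure {x. f x \<noteq> 0})" using assms by (simp add: Cc_def)
  show "f x = 0" if "x \<notin> closure {x. f x \<noteq> 0}" for x
    using that closure_subset[of "{x. f x \<noteq> 0}"] by auto
qed

lemma CcI:
  fixes f :: "'a::t2_space \<Rightarrow> real"
  assumes "continuous_on UNIV f" "compact K" "\<And>x. x \<notin> K \<Longrightarrow> f x = 0"
  shows "f \<in> Cc"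
proof -
  have "closure {x. f x \<noteq> 0} \<subseteq> K"
    using assms by (intro closure_minimal) (auto intro: compact_imp_closed)
  then show ?thesis
    unfolding Cc_def using assms compact_Int_closed[of K "closure {x. f x \<noteq> 0}"]
    by (auto simp: inf_absorb2)
qed

lemma Cc_mult_continuous:
  fixes f :: "'a::t2_space \<Rightarrow> real"
  assumes "f \<in> Cc" "continuous_on UNIV g"
  shows "(\<lambda>x. f x * g x) \<in> Cc"
proof -
  obtain K where "compact K" "\<And>x. x \<notin> K \<Longrightarrow> f x = 0"
    using Cc_support[OF assms(1)] by metis
  then show ?thesis
    using assms by (intro CcI[of _ K]) (auto intro!: continuous_on_mult intro: Cc_continuous)
qed

lemma Cc_zero: "(\<lambda>x. 0) \<in> Cc"
  by (simp add: Cc_def)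

lemma Cc_add:
  fixes f g :: "'a::t2_space \<Rightarrow> real"
  assumes f: "f \<in> Cc" and g: "g \<in> Cc"
  shows "(\<lambda>x. f x + g x) \<in> Cc"
proof -
  obtain K L where "compact K" "\<And>x. x \<notin> K \<Longrightarrow> f x = 0" "compact L" "\<And>x. x \<notin> L \<Longrightarrow> g x = 0"
    using Cc_support[OF f] Cc_support[OF g] by metis
  then show ?thesis
    by (intro CcI[of _ "K \<union> L"]) (auto intro!: continuous_on_add intro: Cc_continuous f g)
qed

lemma Cc_scale:
  fixes f :: "'a::t2_space \<Rightarrow> real"
  assumes "f \<in> Cc"
  shows "(\<lambda>x. c * f x) \<in> Cc"
  using Cc_mult_continuous[OF assms, of "\<lambda>_. c"] by (simp add: mult.commute)

lemma Cc_diff: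
  fixes f g :: "'a::t2_space \<Rightarrow> real"
  assumes "f \<in> Cc" "g \<in> Cc"
  shows "(\<lambda>x. f x - g x) \<in> Cc"
  using Cc_add[OF assms(1) Cc_scale[OF assms(2), of "-1"]] by simp

lemma Cc_sum:
  fixes f :: "'i \<Rightarrow> 'a::t2_space \<Rightarrow> real"
  assumes "\<And>i. i \<in> A \<Longrightarrow> f i \<in> Cc"
  shows "(\<lambda>x. \<Sum>i\<in>A. f i x) \<in> Cc"
  using assms
  by (induction A rule: infinite_finite_induct) (auto simp: Cc_zero intro!: Cc_add)

lemma Cc_min_const:
  fixes f :: "'a::t2_space \<Rightarrow> real"
  assumes f: "f \<in> Cc" and "c \<ge> 0"
  shows "(\<lambda>x. min (f x) c) \<in> Cc"
proof -
  obtain K where "compact K" "\<And>x. x \<notin> K \<Longrightarrow> f x = 0"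
    using Cc_support[OF f] by metis
  then show ?thesis
    using assms by (intro CcI[of _ K]) (auto intro!: continuous_on_min continuous_on_max intro: Cc_continuous f)
qed

lemma Cc_max_zero:
  fixes f :: "'a::t2_space \<Rightarrow> real"
  assumes f: "f \<in> Cc"
  shows "(\<lambda>x. max (f x) 0) \<in> Cc"
proof -
  obtain K where "compact K" "\<And>x. x \<notin> K \<Longrightarrow> f x = 0"
    using Cc_support[OF f] by metis
  then show ?thesis
    using assms by (intro CcI[of _ K]) (auto intro!: continuous_on_min continuous_on_max intro: Cc_continuous f)
qed

lemma Cc_bounded:
  assumes f: "f \<in> Cc"
  obtains B where "B > 0" "\<And>x. \<bar>f x\<bar> \<le> B"
proof -
  obtain K where K: "compact K" "\<And>x. x \<notin> K \<Longrightarrow> f x = 0"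
    using Cc_support[OF f] by metis
  have "compact (f ` K)"
    using K f by (intro compact_continuous_image) (auto intro: continuous_on_subset Cc_continuous)
  then obtain B where B: "\<And>y. y \<in> f ` K \<Longrightarrow> \<bar>y\<bar> \<le> B"
    by (metis compact_imp_bounded bounded_iff real_norm_def)
  show ?thesis
  proof
    show "max B 1 > 0" by simp
    show "\<bar>f x\<bar> \<le> max B 1" for x
      using B[of "f x"] K(2)[of x] by (cases "x \<in> K") auto
  qed
qed

lemma Cc_integrable:
  fixes f :: "'a::t2_space \<Rightarrow> real"
  assumes \<mu>: "\<mu> \<in> radon_measures" and f: "f \<in> Cc"
  shows "integrable \<mu> f"
proof -
  obtain K where K: "compact K" "\<And>x. x \<notin> K \<Longrightarrow> f x = 0"
    using Cc_support[OF f] by metis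
  obtain B where B: "B > 0" "\<And>x. \<bar>f x\<bar> \<le> B"
    using Cc_bounded[OF f] by metis
  have sets: "sets \<mu> = sets borel" and fin: "emeasure \<mu> K < \<infinity>"
    using \<mu> K by (auto simp: radon_measures_def)
  have "integrable \<mu> (\<lambda>x. B * indicator K x :: real)"
    using fin K by (intro integrable_mult_right integrable_real_indicator)
      (auto simp: sets intro!: borel_closed compact_imp_closed)
  then show ?thesis
  proof (rule Bochner_Integration.integrable_bound)
    show "f \<in> borel_measurable \<mu>"
      using Cc_borel[OF f] measurable_cong_sets[OF sets refl] by blast
    show "AE x in \<mu>. norm (f x) \<le> norm (B * indicator K x :: real)"
      using B K by (intro AE_I2) (auto simp: indicator_def)
  qed
qed

text \<open>Local compactness and Hausdorff separation give complete regularity. Separating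
  \<open>x\<close> from the complement of \<open>U \<inter> V\<close>, with \<open>V\<close> inside
  a compact \<open>K\<close>, yields vanishing off \<open>U\<close> and compact support
  together.\<close>

lemma locally_compact_Cc_bump:
  fixes x :: "'a::t2_space"
  assumes lc: "locally_compact_space (euclidean :: 'a topology)" and U: "open U" "x \<in> U"
  obtains f where "f \<in> Cc" "f x = 1" "\<And>y. 0 \<le> f y" "\<And>y. f y \<le> 1" "\<And>y. y \<notin> U \<Longrightarrow> f y = 0"
proof -
  obtain V K where V: "open V" "compact K" "x \<in> V" "V \<subseteq> K"
    using lc unfolding locally_compact_space_def by simp metis
  have "Hausdorff_space (euclidean :: 'a topology)"
    by (simp add: Hausdorff_space_def) (metis disjnt_def hausdorff)
  then have "completely_regular_space (euclidean :: 'a topology)"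
    using lc locally_compact_regular_imp_completely_regular_space by blast
  moreover have "closedin euclidean (- (U \<inter> V))" "x \<in> topspace euclidean - (- (U \<inter> V))"
    using U V by auto
  ultimately obtain f :: "'a \<Rightarrow> real" where f: "continuous_map euclidean (top_of_set {0..1}) f"
      "f x = 0" "f ` (- (U \<inter> V)) \<subseteq> {1}"
    unfolding completely_regular_space_def by meson
  have cont: "continuous_on UNIV f" and r: "\<And>y. f y \<in> {0..1}"
    using f(1) by (auto simp: continuous_map_in_subtopology)
  show ?thesis
  proof
    show "(\<lambda>y. 1 - f y) \<in> Cc"
      using V f(3) cont by (intro CcI[of _ K]) (auto intro!: continuous_intros)
  qed (use f r in auto)
qed

text \<open>The sets where a bump exceeds \<open>1/2\<close> cover \<open>K\<close>. Doubling a
  finite subfamily turns that threshold into 1, and the other summands can only help.\<close>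

lemma locally_compact_Cc_ge_one_on_compact:
  fixes K :: "'a::t2_space set"
  assumes lc: "locally_compact_space (euclidean :: 'a topology)" and K: "compact K"
  obtains e where "e \<in> Cc" "\<And>y. 0 \<le> e y" "\<And>y. y \<in> K \<Longrightarrow> e y \<ge> 1"
proof -
  have "\<exists>f. f \<in> Cc \<and> f x = 1 \<and> (\<forall>y. 0 \<le> f y)" for x :: 'a
    using locally_compact_Cc_bump[OF lc, of UNIV x] by (metis UNIV_I open_UNIV)
  then obtain b where b: "\<And>x. b x \<in> Cc" "\<And>x::'a. b x x = 1" "\<And>x y. 0 \<le> b x y"
    by metis
  have op: "open {y. b x y > 1/2}" for x
    using b by (intro open_Collect_less) (auto intro: Cc_continuous)
  obtain T where T: "T \<subseteq> K" "finite T" "K \<subseteq> (\<Union>x\<in>T. {y. b x y > 1/2})"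
  proof (rule compactE_image[OF K, of K "\<lambda>x. {y. b x y > 1/2}"])
    show "K \<subseteq> (\<Union>x\<in>K. {y. b x y > 1/2})"
    proof
      fix x assume "x \<in> K"
      then show "x \<in> (\<Union>x\<in>K. {y. b x y > 1/2})"
        by (intro UN_I[of x]) (simp_all add: b(2))
    qed
  qed (use op in auto)
  show ?thesis
  proof
    show "(\<lambda>y. \<Sum>x\<in>T. 2 * b x y) \<in> Cc"
      by (intro Cc_sum Cc_scale b)
    show "0 \<le> (\<Sum>x\<in>T. 2 * b x y)" for y
      by (intro sum_nonneg) (simp add: b)
    show "(\<Sum>x\<in>T. 2 * b x y) \<ge> 1" if y: "y \<in> K" for y
    proof -
      obtain x where x: "x \<in> T" "b x y > 1/2" using y T by blast
      then have "1 \<le> 2 * b x y" by simp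
      also have "\<dots> \<le> (\<Sum>x\<in>T. 2 * b x y)"
        using x T b by (intro member_le_sum) auto
      finally show ?thesis .
    qed
  qed
qed

text \<open>By Lindelof, the union of all positivity sets inside \<open>U\<close> reduces to a
  countable one, which a sigma-algebra can form. The case of the whole space later gives the
  exhaustion by sets of finite measure used for uniqueness.\<close>

lemma open_eq_countable_Union_Cc_positive:
  fixes U :: "'a::{t2_space, second_countable_topology} set"
  assumes lc: "locally_compact_space (euclidean :: 'a topology)" and U: "open U"
  obtains \<F> where "countable \<F>" "\<F> \<subseteq> {{x. f x > 0} | f. f \<in> Cc \<and> (\<forall>x. 0 \<le> f x)}" "U = \<Union>\<F>"
proof -
  define \<G> where "\<G> = {{x. f x > 0} | f. f \<in> Cc \<and> (\<forall>x. 0 \<le> f x) \<and> {x. f x > 0} \<subseteq> U}"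
  have "open S" if "S \<in> \<G>" for S
    using that unfolding \<G>_def by (auto intro!: open_Collect_less intro: Cc_continuous)
  from Lindelof[OF this]
  obtain \<F> where \<F>: "\<F> \<subseteq> \<G>" "countable \<F>" "\<Union>\<F> = \<Union>\<G>"
    by metis
  have "x \<in> \<Union>\<G>" if x: "x \<in> U" for x
  proof -
    obtain f where f: "f \<in> Cc" "f x = 1" "\<And>y. 0 \<le> f y" "\<And>y. y \<notin> U \<Longrightarrow> f y = 0"
      using locally_compact_Cc_bump[OF lc U x] by metis
    have "{x. f x > 0} \<subseteq> U" using f(4) by (metis less_irrefl mem_Collect_eq subsetI)
    then have "{x. f x > 0} \<in> \<G>" unfolding \<G>_def using f(1,3) by blast
    then show ?thesis using f(2) by (intro UnionI[of "{x. f x > 0}"]) auto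
  qed
  then have "U = \<Union>\<F>" using \<F>(3) unfolding \<G>_def by blast
  moreover have "\<F> \<subseteq> {{x. f x > 0} | f. f \<in> Cc \<and> (\<forall>x. 0 \<le> f x)}"
    using \<F>(1) unfolding \<G>_def by blast
  ultimately show ?thesis using that \<F>(2) by blast
qed

lemma borel_eq_sigma_sets_Cc_positive:
  assumes lc: "locally_compact_space (euclidean :: 'a::{t2_space, second_countable_topology} topology)"
  shows "sets (borel :: 'a measure) = sigma_sets UNIV {{x. f x > 0} | f. f \<in> Cc \<and> (\<forall>x. 0 \<le> f x)}"
    (is "_ = sigma_sets UNIV ?E")
proof
  have "U \<in> sigma_sets UNIV ?E" if U: "open U" for U
  proof -
    obtain \<F> where \<F>: "countable \<F>" "\<F> \<subseteq> ?E" "U = \<Union>\<F>"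
      by (rule open_eq_countable_Union_Cc_positive[OF lc U])
    have "\<Union>\<F> \<in> sigma_sets UNIV ?E"
    proof (rule sigma_algebra.countable_Union[OF sigma_algebra_sigma_sets])
      show "\<F> \<subseteq> sigma_sets UNIV ?E" using \<F>(2) sigma_sets.Basic by blast
    qed (use \<F> in auto)
    then show ?thesis using \<F>(3) by simp
  qed
  then show "sets borel \<subseteq> sigma_sets UNIV ?E"
    unfolding borel_def by (simp, intro sigma_sets_mono) auto
  have "S \<in> sets borel" if "S \<in> ?E" for S
    using that by (auto intro!: borel_open open_Collect_less intro: Cc_continuous)
  then show "sigma_sets UNIV ?E \<subseteq> sets borel"
    using sets.sigma_sets_subset[of ?E borel] by auto
qed

section \<open>Riesz representation\<close>

lemma suminf_half_epsilon:
  assumes "\<epsilon> \<ge> 0"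
  shows "(\<Sum>i. ennreal (\<epsilon> * (1/2) ^ Suc i)) = ennreal \<epsilon>"
proof -
  have "(\<lambda>i. \<epsilon> * (1/2) ^ Suc i) sums (\<epsilon> * 1)"
    by (intro sums_mult power_half_series)
  then show ?thesis using assms by (intro suminf_ennreal_eq) auto
qed

text \<open>Kept abstract because it is instantiated both by a point \<open>z\<close> of the
  product, to which Riesz is applied, and by integration itself, so that one slicing estimate bounds
  the two functionals.\<close>

locale positive_functional =
  fixes \<Lambda> :: "('a::{t2_space, second_countable_topology} \<Rightarrow> real) \<Rightarrow> real"
  assumes lc: "locally_compact_space (euclidean :: 'a topology)"
    and add: "f \<in> Cc \<Longrightarrow> g \<in> Cc \<Longrightarrow> \<Lambda> (\<lambda>x. f x + g x) = \<Lambda> f + \<Lambda> g"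
    and scale: "f \<in> Cc \<Longrightarrow> \<Lambda> (\<lambda>x. c * f x) = c * \<Lambda> f"
    and pos: "f \<in> Cc \<Longrightarrow> (\<And>x. 0 \<le> f x) \<Longrightarrow> 0 \<le> \<Lambda> f"
begin

lemma zero: "\<Lambda> (\<lambda>x. 0) = 0"
  using scale[OF Cc_zero, of 0] by simp

lemma diff:
  assumes "f \<in> Cc" "g \<in> Cc"
  shows "\<Lambda> (\<lambda>x. f x - g x) = \<Lambda> f - \<Lambda> g"
  using add[OF assms(1) Cc_scale[OF assms(2), of "-1"]] scale[OF assms(2), of "-1"] by simp

lemma mono:
  assumes "f \<in> Cc" "g \<in> Cc" "\<And>x. f x \<le> g x"
  shows "\<Lambda> f \<le> \<Lambda> g"
  using pos[OF Cc_diff[OF assms(2,1)]] diff[OF assms(2,1)] assms(3) by simp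

lemma sum:
  assumes "\<And>i. i \<in> A \<Longrightarrow> f i \<in> Cc"
  shows "\<Lambda> (\<lambda>x. \<Sum>i\<in>A. f i x) = (\<Sum>i\<in>A. \<Lambda> (f i))"
  using assms
proof (induction A rule: infinite_finite_induct)
  case (insert i A)
  then show ?case using add[of "f i" "\<lambda>x. \<Sum>i\<in>A. f i x"] by (simp add: Cc_sum)
qed (simp_all add: zero)

text \<open>Dini's argument on the compact support of \<open>f\<close> makes the countable domination finite.\<close>
lemma countable_domination:
  assumes f: "f \<in> Cc" and g: "\<And>n. g n \<in> Cc" "\<And>n x. 0 \<le> g n x"
    and le: "\<And>x. ennreal (f x) \<le> (\<Sum>n. ennreal (g n x))"
  shows "ennreal (\<Lambda> f) \<le> (\<Sum>n::nat. ennreal (\<Lambda> (g n)))"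
proof (rule ennreal_le_epsilon)
  fix \<epsilon>' :: real assume \<epsilon>': "\<epsilon>' > 0"
  obtain K where K: "compact K" "\<And>x. x \<notin> K \<Longrightarrow> f x = 0"
    using Cc_support[OF f] by metis
  obtain e where e: "e \<in> Cc" "\<And>y. 0 \<le> e y" "\<And>y. y \<in> K \<Longrightarrow> e y \<ge> 1"
    using locally_compact_Cc_ge_one_on_compact[OF lc K(1)] by metis
  have \<Lambda>e: "0 \<le> \<Lambda> e" using e pos by blast
  \<comment> \<open>The added \<open>\<epsilon> * e\<close>, at least \<open>\<epsilon>\<close> on
    \<open>K\<close>, makes the domination strict and so gives the open sets \<open>V N\<close>. Its
    cost under \<open>\<Lambda>\<close> is at most \<open>\<epsilon>'\<close>; the
    \<open>+ 1\<close> covers \<open>\<Lambda> e = 0\<close>.\<close>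
  define \<epsilon> where "\<epsilon> = \<epsilon>' / (\<Lambda> e + 1)"
  have \<epsilon>: "\<epsilon> > 0" "\<epsilon> * \<Lambda> e \<le> \<epsilon>'"
    using \<Lambda>e \<epsilon>' by (auto simp: \<epsilon>_def field_simps)
  define V where "V N = {x. f x < (\<Sum>n<N. g n x) + \<epsilon> * e x}" for N
  have opV: "open (V N)" for N
    unfolding V_def
    by (intro open_Collect_less continuous_on_add continuous_on_sum continuous_on_mult
        continuous_on_const Cc_continuous f g e)
  have covK: "K \<subseteq> (\<Union>N. V N)"
  proof
    fix x assume x: "x \<in> K"
    show "x \<in> (\<Union>N. V N)"
    proof (rule ccontr)
      assume "x \<notin> (\<Union>N. V N)"
      then have *: "(\<Sum>n<N. g n x) \<le> f x - \<epsilon> * e x" for N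
        by (auto simp: V_def not_less algebra_simps)
      have "(\<Sum>n<N. ennreal (g n x)) \<le> ennreal (f x - \<epsilon> * e x)" for N
        using *[of N] g by (simp add: sum_ennreal ennreal_leI)
      then have "(\<Sum>n. ennreal (g n x)) \<le> ennreal (f x - \<epsilon> * e x)"
        by (intro suminf_le_const) auto
      with le[of x] have "ennreal (f x) \<le> ennreal (f x - \<epsilon> * e x)" by (rule order_trans)
      moreover have "0 \<le> f x - \<epsilon> * e x" using *[of 0] by simp
      ultimately have "\<epsilon> * e x \<le> 0" by (simp add: ennreal_le_iff)
      then show False using \<epsilon>(1) e(3)[OF x] by (auto simp: mult_le_0_iff)
    qed
  qed
  obtain D where D: "finite D" "K \<subseteq> (\<Union>N\<in>D. V N)"
    using compactE_image[OF K(1), of UNIV V] opV covK by metis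
  define N where "N = Max (insert 0 D)"
  have V_mono: "V i \<subseteq> V N" if "i \<in> D" for i
  proof -
    have "i \<le> N" using that D by (simp add: N_def)
    then have "(\<Sum>n<i. g n x) \<le> (\<Sum>n<N. g n x)" for x
      using g by (intro sum_mono2) auto
    then show ?thesis unfolding V_def by (force intro: less_le_trans)
  qed
  have "f x \<le> (\<Sum>n<N. g n x) + \<epsilon> * e x" for x
  proof (cases "x \<in> K")
    case True
    then show ?thesis using D(2) V_mono unfolding V_def by force
  next
    case False
    then show ?thesis using K(2) g e(2) \<epsilon>(1) by (simp add: sum_nonneg)
  qed
  then have "\<Lambda> f \<le> \<Lambda> (\<lambda>x. (\<Sum>n<N. g n x) + \<epsilon> * e x)"
    by (intro mono Cc_add Cc_sum Cc_scale f g e)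
  also have "\<dots> = (\<Sum>n<N. \<Lambda> (g n)) + \<epsilon> * \<Lambda> e"
    using g e by (simp add: add Cc_sum Cc_scale sum scale)
  finally have "ennreal (\<Lambda> f) \<le> ennreal ((\<Sum>n<N. \<Lambda> (g n)) + \<epsilon>')"
    using \<epsilon>(2) by (intro ennreal_leI) auto
  also have "\<dots> = (\<Sum>n<N. ennreal (\<Lambda> (g n))) + ennreal \<epsilon>'"
    using g \<epsilon>' pos by (subst ennreal_plus) (auto simp: sum_nonneg sum_ennreal)
  also have "\<dots> \<le> (\<Sum>n. ennreal (\<Lambda> (g n))) + ennreal \<epsilon>'"
    by (intro add_right_mono sum_le_suminf) auto
  finally show "ennreal (\<Lambda> f) \<le> (\<Sum>n. ennreal (\<Lambda> (g n))) + ennreal \<epsilon>'" .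
qed

section \<open>Outer measure and Caratheodory measurability\<close>

definition covers :: "'a set \<Rightarrow> (nat \<Rightarrow> 'a \<Rightarrow> real) set" where
  "covers A = {g. (\<forall>n. g n \<in> Cc \<and> (\<forall>x. 0 \<le> g n x)) \<and> (\<forall>x\<in>A. 1 \<le> (\<Sum>n. ennreal (g n x)))}"

definition outer :: "'a set \<Rightarrow> ennreal" where
  "outer A = (INF g\<in>covers A. \<Sum>n. ennreal (\<Lambda> (g n)))"

lemma outer_le: "g \<in> covers A \<Longrightarrow> outer A \<le> (\<Sum>n. ennreal (\<Lambda> (g n)))"
  unfolding outer_def by (rule INF_lower)

lemma outer_approx:
  assumes "outer A < c"
  obtains g where "g \<in> covers A" "(\<Sum>n. ennreal (\<Lambda> (g n))) < c"
  using assms unfolding outer_def INF_less_iff by auto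

lemma outer_mono: "A \<subseteq> B \<Longrightarrow> outer A \<le> outer B"
  unfolding outer_def by (rule INF_superset_mono) (auto simp: covers_def)

lemma outer_le_single:
  assumes "g \<in> Cc" "\<And>x. 0 \<le> g x" "\<And>x. x \<in> A \<Longrightarrow> 1 \<le> g x"
  shows "outer A \<le> ennreal (\<Lambda> g)"
proof -
  let ?g = "\<lambda>n::nat. if n = 0 then g else (\<lambda>x. 0)"
  have "(\<Sum>n. ennreal (?g n x)) = ennreal (g x)" for x
    by (subst suminf_finite[of "{0}"]) auto
  then have "?g \<in> covers A" using assms by (auto simp: covers_def Cc_zero)
  then have "outer A \<le> (\<Sum>n. ennreal (\<Lambda> (?g n)))" by (rule outer_le)
  also have "\<dots> = ennreal (\<Lambda> g)"
    by (subst suminf_finite[of "{0}"]) (auto simp: zero)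
  finally show ?thesis .
qed

text \<open>Dini's estimate enters here: every cover of \<open>A\<close> dominates \<open>g\<close>,
  since \<open>g \<le> 1\<close> on \<open>A\<close> and \<open>g \<le> 0\<close> off it. This
  prevents countable covers from making \<open>outer\<close> too small.\<close>

lemma le_outer:
  assumes "g \<in> Cc" "\<And>x. g x \<le> 1" "\<And>x. x \<notin> A \<Longrightarrow> g x \<le> 0"
  shows "ennreal (\<Lambda> g) \<le> outer A"
  unfolding outer_def
proof (rule INF_greatest)
  fix h assume h: "h \<in> covers A"
  have "ennreal (g x) \<le> (\<Sum>n. ennreal (h n x))" for x
  proof (cases "x \<in> A")
    case True
    have "ennreal (g x) \<le> 1" using assms(2)[of x] by (simp add: ennreal_le_1)
    also have "1 \<le> (\<Sum>n. ennreal (h n x))" using h True by (auto simp: covers_def)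
    finally show ?thesis .
  next
    case False
    then show ?thesis using assms(3)[of x] by (simp add: ennreal_neg)
  qed
  then show "ennreal (\<Lambda> g) \<le> (\<Sum>n. ennreal (\<Lambda> (h n)))"
    using h by (intro countable_domination assms) (auto simp: covers_def)
qed

lemma outer_empty: "outer {} = 0"
  using outer_le_single[OF Cc_zero, of "{}"] by (simp add: zero)

text \<open>Enumerating pairs by \<open>prod_decode\<close> turns a sequence of sequences into one
  cover. It serves both countable subadditivity and the splitting of a cover into
  increments.\<close>

lemma double_cover:
  assumes g: "\<And>i n. g i n \<in> Cc" "\<And>i n x. 0 \<le> g i n x"
    and one: "\<And>x. x \<in> A \<Longrightarrow> 1 \<le> (\<Sum>i. \<Sum>n. ennreal (g i n x))"
  shows "outer A \<le> (\<Sum>i. \<Sum>n. ennreal (\<Lambda> (g i n)))"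
proof -
  let ?G = "\<lambda>k. g (fst (prod_decode k)) (snd (prod_decode k))"
  have eq: "(\<Sum>k. F (fst (prod_decode k)) (snd (prod_decode k))) = (\<Sum>i. \<Sum>n. F i n)"
    for F :: "nat \<Rightarrow> nat \<Rightarrow> ennreal"
    using suminf_ennreal_2dimen[of "\<lambda>i. \<Sum>n. F i n" "\<lambda>p. F (fst p) (snd p)"] by simp
  have "?G \<in> covers A"
    using g one eq[of "\<lambda>i n. ennreal (g i n _)"] by (auto simp: covers_def)
  from outer_le[OF this] show ?thesis
    using eq[of "\<lambda>i n. ennreal (\<Lambda> (g i n))"] by simp
qed

lemma outer_countable_subadditive: "outer (\<Union>i. A i) \<le> (\<Sum>i::nat. outer (A i))"
proof (rule ennreal_le_epsilon)
  fix \<epsilon> :: real assume \<epsilon>: "\<epsilon> > 0" and fin: "(\<Sum>i. outer (A i)) < top"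
  have "outer (A i) < outer (A i) + ennreal (\<epsilon> * (1/2) ^ Suc i)" for i
  proof -
    have "outer (A i) \<le> (\<Sum>i. outer (A i))"
      using sum_le_suminf[of "\<lambda>i. outer (A i)" "{i}"] by auto
    then have "outer (A i) \<noteq> top" using fin by (auto simp: top_unique)
    then obtain r where r: "outer (A i) = ennreal r" "0 \<le> r" by (cases "outer (A i)") auto
    have "0 < \<epsilon> * (1/2) ^ Suc i" using \<epsilon> by simp
    then show ?thesis unfolding r(1) using r(2) by (subst ennreal_plus[symmetric]) (auto simp: ennreal_less_iff)
  qed
  then have "\<exists>g. g \<in> covers (A i) \<and>
      (\<Sum>n. ennreal (\<Lambda> (g n))) < outer (A i) + ennreal (\<epsilon> * (1/2) ^ Suc i)" for i
    using outer_approx by metis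
  then obtain g where g: "\<And>i. g i \<in> covers (A i)"
    "\<And>i. (\<Sum>n. ennreal (\<Lambda> (g i n))) < outer (A i) + ennreal (\<epsilon> * (1/2) ^ Suc i)"
    by metis
  have "outer (\<Union>i. A i) \<le> (\<Sum>i. \<Sum>n. ennreal (\<Lambda> (g i n)))"
  proof (rule double_cover)
    fix x assume "x \<in> (\<Union>i. A i)"
    then obtain i where "x \<in> A i" by auto
    then have "1 \<le> (\<Sum>n. ennreal (g i n x))" using g(1)[of i] by (auto simp: covers_def)
    also have "\<dots> \<le> (\<Sum>i. \<Sum>n. ennreal (g i n x))"
      using sum_le_suminf[of "\<lambda>i. \<Sum>n. ennreal (g i n x)" "{i}"] by auto
    finally show "1 \<le> (\<Sum>i. \<Sum>n. ennreal (g i n x))" .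
  qed (use g(1) in \<open>auto simp: covers_def\<close>)
  also have "\<dots> \<le> (\<Sum>i. outer (A i) + ennreal (\<epsilon> * (1/2) ^ Suc i))"
    by (intro suminf_le less_imp_le g(2)) auto
  also have "\<dots> = (\<Sum>i. outer (A i)) + (\<Sum>i. ennreal (\<epsilon> * (1/2) ^ Suc i))"
    by (rule suminf_add[symmetric]) auto
  also have "(\<Sum>i. ennreal (\<epsilon> * (1/2) ^ Suc i)) = ennreal \<epsilon>"
    using \<epsilon> by (intro suminf_half_epsilon) simp
  finally show "outer (\<Union>i. A i) \<le> (\<Sum>i. outer (A i)) + ennreal \<epsilon>" .
qed

lemma outer_measure_space_outer: "outer_measure_space (Pow UNIV) outer"
  using outer_countable_subadditive outer_mono
  by (auto simp: outer_measure_space_def positive_def outer_empty increasing_def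
      countably_subadditive_def)

text \<open>With \<open>h\<^sub>k = min 1 (k f)\<close> increasing to the indicator of \<open>U = {f > 0}\<close>, a cover \<open>g\<close> of \<open>A\<close>
  splits into the cover \<open>g\<^sub>n (h\<^bsub>k+1\<^esub> - h\<^sub>k)\<close> of \<open>A \<inter> U\<close> and the cover \<open>g\<^sub>n (1 - h\<^bsub>k(n)\<^esub>)\<close> of \<open>A - U\<close>.\<close>
lemma outer_split_le:
  assumes f: "f \<in> Cc" "\<And>x. 0 \<le> f x" and g: "g \<in> covers A"
  shows "outer ({x. f x > 0} \<inter> A) + outer (A - {x. f x > 0}) \<le> (\<Sum>n. ennreal (\<Lambda> (g n)))"
    (is "outer (?U \<inter> A) + _ \<le> _")
proof (rule ennreal_le_epsilon)
  fix \<epsilon> :: real assume \<epsilon>: "\<epsilon> > 0"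
  have gC: "\<And>n. g n \<in> Cc" "\<And>n x. 0 \<le> g n x"
    and g1: "\<And>x. x \<in> A \<Longrightarrow> 1 \<le> (\<Sum>n. ennreal (g n x))"
    using g by (auto simp: covers_def)
  define h where "h k x = min 1 (real k * f x)" for k x
  have h_cont: "continuous_on UNIV (h k)" for k
    unfolding h_def using f
    by (intro continuous_on_min continuous_on_mult continuous_on_const Cc_continuous)
  have h01: "0 \<le> h k x" "h k x \<le> 1" "h k x \<le> h (Suc k) x" "h 0 x = 0" for k x
    using f(2)[of x] by (auto simp: h_def min_le_iff_disj mult_right_mono)
  define c where "c n k = \<Lambda> (\<lambda>x. g n x * h k x)" for n k
  have ghC: "(\<lambda>x. g n x * h k x) \<in> Cc" for n k
    using gC h_cont by (intro Cc_mult_continuous)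
  have c_le: "c n k \<le> \<Lambda> (g n)" for n k
    unfolding c_def using gC h01 by (intro mono ghC) (auto intro: mult_left_le)
  have c_nonneg: "0 \<le> c n k" for n k
    unfolding c_def using gC h01 by (intro pos ghC) auto
  \<comment> \<open>\<open>c n\<close> is bounded above by \<open>\<Lambda> (g n)\<close>, so its
    supremum is nearly attained at some index. The weights \<open>(1/2) ^ Suc n\<close> make the
    errors sum to \<open>\<epsilon>\<close>.\<close>
  have "\<exists>k. \<forall>j. c n j \<le> c n k + \<epsilon> * (1/2) ^ Suc n" for n
  proof -
    have bdd: "bdd_above (range (c n))" using c_le by (auto intro!: bdd_aboveI)
    have "(SUP j. c n j) - \<epsilon> * (1/2) ^ Suc n < (SUP j. c n j)" using \<epsilon> by simp
    then obtain k where "(SUP j. c n j) - \<epsilon> * (1/2) ^ Suc n < c n k"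
      using less_cSUP_iff[OF _ bdd] by auto
    then show ?thesis using cSUP_upper[OF _ bdd] by (intro exI[of _ k]) (smt (verit) UNIV_I)
  qed
  then obtain k where k: "\<And>n j. c n j \<le> c n (k n) + \<epsilon> * (1/2) ^ Suc n" by metis
  have "outer (?U \<inter> A) \<le> (\<Sum>n. \<Sum>j. ennreal (\<Lambda> (\<lambda>x. g n x * h (Suc j) x - g n x * h j x)))"
  proof (rule double_cover)
    fix x assume x: "x \<in> ?U \<inter> A"
    have "ennreal (g n x) \<le> (\<Sum>j. ennreal (g n x * h (Suc j) x - g n x * h j x))" for n
    proof -
      obtain N where N: "1 \<le> real N * f x"
        using x reals_Archimedean3[of "f x"] by (metis IntD1 less_imp_le mem_Collect_eq)
      have "(\<Sum>j<N. ennreal (g n x * h (Suc j) x - g n x * h j x)) =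
          ennreal (\<Sum>j<N. g n x * h (Suc j) x - g n x * h j x)"
        using gC h01 by (intro sum_ennreal) (auto intro!: mult_left_mono)
      also have "(\<Sum>j<N. g n x * h (Suc j) x - g n x * h j x) = g n x"
        using N h01(4) by (subst sum_lessThan_telescope) (simp add: h_def)
      finally show ?thesis
        using sum_le_suminf[of "\<lambda>j. ennreal (g n x * h (Suc j) x - g n x * h j x)" "{..<N}"] by auto
    qed
    then have "(\<Sum>n. ennreal (g n x)) \<le>
        (\<Sum>n. \<Sum>j. ennreal (g n x * h (Suc j) x - g n x * h j x))"
      by (intro suminf_le) auto
    then show "1 \<le> (\<Sum>n. \<Sum>j. ennreal (g n x * h (Suc j) x - g n x * h j x))"
      using g1[of x] x by (auto intro: order_trans)
  qed (use gC h01 in \<open>auto intro!: Cc_diff ghC mult_left_mono\<close>)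
  \<comment> \<open>For each \<open>n\<close> the partial sums over \<open>j\<close> telescope to
    \<open>c n N - c n 0\<close>, which the choice of \<open>k n\<close> bounds independently of
    \<open>N\<close>.\<close>
  also have "\<dots> \<le> (\<Sum>n. ennreal (c n (k n) + \<epsilon> * (1/2) ^ Suc n))"
  proof (intro suminf_le suminf_le_const)
    fix n N
    have "(\<Sum>j<N. ennreal (\<Lambda> (\<lambda>x. g n x * h (Suc j) x - g n x * h j x))) =
        (\<Sum>j<N. ennreal (c n (Suc j) - c n j))"
      by (simp add: c_def diff[OF ghC ghC])
    also have "\<dots> = ennreal (\<Sum>j<N. c n (Suc j) - c n j)"
      unfolding c_def using gC h01 by (intro sum_ennreal) (auto intro!: mono ghC mult_left_mono)
    also have "\<dots> \<le> ennreal (c n (k n) + \<epsilon> * (1/2) ^ Suc n)"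
      using k[of n N] c_nonneg[of n 0] by (subst sum_lessThan_telescope) (intro ennreal_leI, auto)
    finally show "(\<Sum>j<N. ennreal (\<Lambda> (\<lambda>x. g n x * h (Suc j) x - g n x * h j x)))
        \<le> ennreal (c n (k n) + \<epsilon> * (1/2) ^ Suc n)" .
  qed auto
  finally have 1: "outer (?U \<inter> A) \<le> (\<Sum>n. ennreal (c n (k n) + \<epsilon> * (1/2) ^ Suc n))" .
  have "outer (A - ?U) \<le> (\<Sum>n. ennreal (\<Lambda> (\<lambda>x. g n x - g n x * h (k n) x)))"
  proof (rule outer_le)
    have "h j x = 0" if "\<not> f x > 0" for j x
      using that f(2)[of x] by (simp add: h_def)
    then show "(\<lambda>n x. g n x - g n x * h (k n) x) \<in> covers (A - ?U)"
      using g1 gC h01(2) by (auto simp: covers_def intro!: Cc_diff ghC mult_left_le)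
  qed
  also have "\<dots> = (\<Sum>n. ennreal (\<Lambda> (g n) - c n (k n)))"
    by (simp add: c_def diff[OF gC(1) ghC])
  finally have 2: "outer (A - ?U) \<le> (\<Sum>n. ennreal (\<Lambda> (g n) - c n (k n)))" .
  have "outer (?U \<inter> A) + outer (A - ?U) \<le>
      (\<Sum>n. ennreal (c n (k n) + \<epsilon> * (1/2) ^ Suc n)) + (\<Sum>n. ennreal (\<Lambda> (g n) - c n (k n)))"
    by (rule add_mono[OF 1 2])
  also have "\<dots> = (\<Sum>n. ennreal (c n (k n) + \<epsilon> * (1/2) ^ Suc n) + ennreal (\<Lambda> (g n) - c n (k n)))"
    by (rule suminf_add) auto
  \<comment> \<open>The term \<open>c n (k n)\<close> cancels between the two covers, leaving the
    cost of the original cover plus the error.\<close>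
  also have "\<dots> = (\<Sum>n. ennreal (\<Lambda> (g n)) + ennreal (\<epsilon> * (1/2) ^ Suc n))"
  proof (intro suminf_cong)
    fix n
    have "0 \<le> \<epsilon> * (1/2) ^ Suc n" using \<epsilon> by simp
    then show "ennreal (c n (k n) + \<epsilon> * (1/2) ^ Suc n) + ennreal (\<Lambda> (g n) - c n (k n)) =
        ennreal (\<Lambda> (g n)) + ennreal (\<epsilon> * (1/2) ^ Suc n)"
      using c_nonneg[of n "k n"] c_le[of n "k n"] by (subst (1 2) ennreal_plus[symmetric]) auto
  qed
  also have "\<dots> = (\<Sum>n. ennreal (\<Lambda> (g n))) + (\<Sum>n. ennreal (\<epsilon> * (1/2) ^ Suc n))"
    by (rule suminf_add[symmetric]) auto
  also have "(\<Sum>n. ennreal (\<epsilon> * (1/2) ^ Suc n)) = ennreal \<epsilon>"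
    using \<epsilon> by (intro suminf_half_epsilon) simp
  finally show "outer (?U \<inter> A) + outer (A - ?U) \<le> (\<Sum>n. ennreal (\<Lambda> (g n))) + ennreal \<epsilon>" .
qed

text \<open>The lambda system is a sigma-algebra by Caratheodory, so testing the generators
  \<open>{f > 0}\<close> suffices. There \<open>outer_split_le\<close>, minimised over all covers of
  \<open>A\<close>, gives one inequality; the other is subadditivity.\<close>

lemma borel_subset_lambda_system: "sets borel \<subseteq> lambda_system UNIV (Pow UNIV) outer"
proof -
  have "measure_space UNIV (lambda_system UNIV (Pow UNIV) outer) outer"
    by (rule sigma_algebra.caratheodory_lemma[OF sigma_algebra_Pow outer_measure_space_outer])
  then have sa: "sigma_algebra UNIV (lambda_system UNIV (Pow UNIV) outer)"
    by (simp add: measure_space_def)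
  have "{x. f x > 0} \<in> lambda_system UNIV (Pow UNIV) outer" if f: "f \<in> Cc" "\<forall>x. 0 \<le> f x" for f
  proof -
    have "outer ({x. f x > 0} \<inter> A) + outer ((UNIV - {x. f x > 0}) \<inter> A) = outer A" for A
    proof (rule antisym)
      have eq: "(UNIV - {x. f x > 0}) \<inter> A = A - {x. f x > 0}" by auto
      show "outer ({x. f x > 0} \<inter> A) + outer ((UNIV - {x. f x > 0}) \<inter> A) \<le> outer A"
        unfolding eq outer_def[of A] using f by (intro INF_greatest outer_split_le) auto
      let ?B = "\<lambda>i::nat. if i = 0 then {x. f x > 0} \<inter> A else if i = 1 then (UNIV - {x. f x > 0}) \<inter> A else {}"
      have "outer A \<le> outer (\<Union>i. ?B i)" by (rule outer_mono) (auto split: if_splits)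
      also have "\<dots> \<le> (\<Sum>i. outer (?B i))" by (rule outer_countable_subadditive)
      also have "\<dots> = (\<Sum>i\<in>{0,1}. outer (?B i))"
        by (rule suminf_finite) (auto simp: outer_empty)
      finally show "outer A \<le> outer ({x. f x > 0} \<inter> A) + outer ((UNIV - {x. f x > 0}) \<inter> A)" by simp
    qed
    then show ?thesis by (simp add: lambda_system_def)
  qed
  then show ?thesis
    unfolding borel_eq_sigma_sets_Cc_positive[OF lc]
    by (intro sigma_algebra.sigma_sets_subset[OF sa]) auto
qed

section \<open>The representing measure and its integral\<close>

definition rep :: "'a measure" where
  "rep = measure_of UNIV (sets borel) outer"

lemma sets_rep: "sets rep = sets borel"
  unfolding rep_def by (subst sets_measure_of) (use sets.sigma_sets_eq[of borel] in auto)

lemma emeasure_rep: "A \<in> sets borel \<Longrightarrow> emeasure rep A = outer A"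
proof -
  assume A: "A \<in> sets borel"
  have "measure_space UNIV (lambda_system UNIV (Pow UNIV) outer) outer"
    by (rule sigma_algebra.caratheodory_lemma[OF sigma_algebra_Pow outer_measure_space_outer])
  then have "measure_space UNIV (sets borel) outer"
    by (rule measure_down)
       (use borel_subset_lambda_system sets.sigma_algebra_axioms[of borel] in simp_all)
  then show ?thesis
    unfolding rep_def measure_space_def using A by (intro emeasure_measure_of_sigma) auto
qed

lemma rep_radon: "rep \<in> radon_measures"
proof -
  have "emeasure rep K < \<infinity>" if K: "compact K" for K
  proof -
    obtain e where e: "e \<in> Cc" "\<And>y. 0 \<le> e y" "\<And>y. y \<in> K \<Longrightarrow> e y \<ge> 1"
      using locally_compact_Cc_ge_one_on_compact[OF lc K] by metis
    have "outer K \<le> ennreal (\<Lambda> e)" by (rule outer_le_single) (use e in auto)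
    then show ?thesis
      using K by (simp add: emeasure_rep borel_closed compact_imp_closed le_less_trans)
  qed
  then show ?thesis by (simp add: radon_measures_def sets_rep)
qed

text \<open>Cutting \<open>f\<close> into horizontal slices of height \<open>\<delta>\<close> determines \<open>\<Lambda> f\<close> up to \<open>\<delta> u 0\<close>, because the two
  bounds telescope.\<close>
lemma slice_bounds:
  assumes f: "f \<in> Cc" "\<And>x. 0 \<le> f x" "\<And>x. f x \<le> real N * \<delta>" and \<delta>: "\<delta> > 0"
    and up: "\<And>t g. 0 \<le> t \<Longrightarrow> g \<in> Cc \<Longrightarrow> (\<And>x. 0 \<le> g x) \<Longrightarrow> (\<And>x. g x \<le> 1) \<Longrightarrow>
        (\<And>x. f x \<le> t \<Longrightarrow> g x = 0) \<Longrightarrow> \<Lambda> g \<le> u t"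
    and lo: "\<And>t g. 0 \<le> t \<Longrightarrow> g \<in> Cc \<Longrightarrow> (\<And>x. 0 \<le> g x) \<Longrightarrow>
        (\<And>x. f x > t \<Longrightarrow> 1 \<le> g x) \<Longrightarrow> u t \<le> \<Lambda> g"
  shows "\<Lambda> f \<le> (\<Sum>j<N. \<delta> * u (real j * \<delta>))" "(\<Sum>j<N. \<delta> * u (real (Suc j) * \<delta>)) \<le> \<Lambda> f"
proof -
  \<comment> \<open>\<open>s j\<close> is the part of \<open>f\<close> between heights
    \<open>j * \<delta>\<close> and \<open>(j + 1) * \<delta>\<close>. Divided by
    \<open>\<delta>\<close>, it lies between the indicators of \<open>f > (j + 1) * \<delta>\<close>
    and of \<open>f > j * \<delta>\<close>, so \<open>lo\<close> and \<open>up\<close> apply at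
    consecutive levels.\<close>
  define s where "s j x = min (f x) (real (Suc j) * \<delta>) - min (f x) (real j * \<delta>)" for j x
  have sC: "s j \<in> Cc" for j
    unfolding s_def using f \<delta> by (intro Cc_diff Cc_min_const) auto
  have "(\<Sum>j<N. s j x) = f x" for x
    unfolding s_def using f(2,3)[of x]
    by (subst sum_lessThan_telescope[of "\<lambda>j. min (f x) (real j * \<delta>)"]) auto
  then have "\<Lambda> f = \<Lambda> (\<lambda>x. \<Sum>j<N. s j x)" by simp
  also have "\<dots> = (\<Sum>j<N. \<Lambda> (s j))" using sC by (intro sum)
  also have "\<dots> = (\<Sum>j<N. \<delta> * \<Lambda> (\<lambda>x. (1 / \<delta>) * s j x))"
    unfolding scale[OF sC] using \<delta> by simp
  finally have eq: "\<Lambda> f = (\<Sum>j<N. \<delta> * \<Lambda> (\<lambda>x. (1 / \<delta>) * s j x))" .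
  have s0: "0 \<le> s j x" "s j x \<le> \<delta>" for j x
    using \<delta> unfolding s_def by (auto simp: min_def algebra_simps)
  have "\<Lambda> (\<lambda>x. (1 / \<delta>) * s j x) \<le> u (real j * \<delta>)" for j
  proof (rule up)
    show "(1 / \<delta>) * s j x = 0" if "f x \<le> real j * \<delta>" for x
      using that \<delta> unfolding s_def by (auto simp: min_def algebra_simps)
    show "(1 / \<delta>) * s j x \<le> 1" for x using s0(2)[of j x] \<delta> by (simp add: field_simps)
  qed (rule Cc_scale[OF sC] | use \<delta> s0 in simp)+
  then show "\<Lambda> f \<le> (\<Sum>j<N. \<delta> * u (real j * \<delta>))"
    unfolding eq using \<delta> by (intro sum_mono mult_left_mono) auto
  have "u (real (Suc j) * \<delta>) \<le> \<Lambda> (\<lambda>x. (1 / \<delta>) * s j x)" for j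
  proof (rule lo)
    show "1 \<le> (1 / \<delta>) * s j x" if "real (Suc j) * \<delta> < f x" for x
      using that \<delta> unfolding s_def by (auto simp: min_def field_simps)
  qed (rule Cc_scale[OF sC] | use \<delta> s0 in simp)+
  then show "(\<Sum>j<N. \<delta> * u (real (Suc j) * \<delta>)) \<le> \<Lambda> f"
    unfolding eq using \<delta> by (intro sum_mono mult_left_mono) auto
qed

end

lemma integral_positive_functional:
  assumes lc: "locally_compact_space (euclidean :: 'a::{t2_space, second_countable_topology} topology)"
    and \<mu>: "\<mu> \<in> radon_measures"
  shows "positive_functional (\<lambda>f :: 'a \<Rightarrow> real. integral\<^sup>L \<mu> f)"
  by unfold_locales (use lc Cc_integrable[OF \<mu>] in \<open>auto simp: Bochner_Integration.integral_nonneg\<close>)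

context positive_functional
begin

text \<open>Both functionals satisfy the slicing bounds with the same function \<open>u\<close>:
  \<open>\<Lambda>\<close> by comparison with \<open>outer\<close>, the integral by comparison with
  indicators. They therefore differ by at most \<open>\<delta> * u 0\<close>, and
  \<open>\<delta>\<close> tends to 0.\<close>

lemma integral_rep_nonneg:
  assumes f: "f \<in> Cc" "\<And>x. 0 \<le> f x"
  shows "integral\<^sup>L rep f = \<Lambda> f"
proof -
  interpret int: positive_functional "\<lambda>f. integral\<^sup>L rep f"
    by (rule integral_positive_functional[OF lc rep_radon])
  obtain B where B: "B > 0" "\<And>x. \<bar>f x\<bar> \<le> B"
    using Cc_bounded[OF f(1)] by metis
  obtain K where K: "compact K" "\<And>x. x \<notin> K \<Longrightarrow> f x = 0"
    using Cc_support[OF f(1)] by metis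
  have bor: "{x. t < f x} \<in> sets borel" for t
    using f(1) by (intro borel_open open_Collect_less) (auto intro: Cc_continuous)
  have fin: "emeasure rep {x. t < f x} < \<infinity>" if "0 \<le> t" for t
  proof -
    have "{x. t < f x} \<subseteq> K" using K(2) that by force
    then have "emeasure rep {x. t < f x} \<le> emeasure rep K"
      using K by (intro emeasure_mono) (auto simp: sets_rep intro!: borel_closed compact_imp_closed)
    also have "\<dots> < \<infinity>" using rep_radon K(1) by (auto simp: radon_measures_def)
    finally show ?thesis .
  qed
  define u where "u t = measure rep {x. t < f x}" for t
  have u: "ennreal (u t) = outer {x. t < f x}" if "0 \<le> t" for t
    using fin[OF that] emeasure_rep[OF bor] unfolding u_def
    by (metis emeasure_eq_ennreal_measure infinity_ennreal_def less_irrefl)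
  have \<Lambda>up: "\<Lambda> g \<le> u t" if "0 \<le> t" "g \<in> Cc" "\<And>x. 0 \<le> g x" "\<And>x. g x \<le> 1"
    "\<And>x. f x \<le> t \<Longrightarrow> g x = 0" for t g
  proof -
    have "ennreal (\<Lambda> g) \<le> ennreal (u t)"
      unfolding u[OF that(1)] using that by (intro le_outer) auto
    then show ?thesis by (simp add: u_def ennreal_le_iff)
  qed
  have \<Lambda>lo: "u t \<le> \<Lambda> g" if "0 \<le> t" "g \<in> Cc" "\<And>x. 0 \<le> g x" "\<And>x. f x > t \<Longrightarrow> 1 \<le> g x" for t g
  proof -
    have "ennreal (u t) \<le> ennreal (\<Lambda> g)"
      unfolding u[OF that(1)] using that by (intro outer_le_single) auto
    then show ?thesis using pos[of g] that by (simp add: ennreal_le_iff)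
  qed
  have ind: "integrable rep (indicator {x. t < f x} :: 'a \<Rightarrow> real)"
    "integral\<^sup>L rep (indicator {x. t < f x} :: 'a \<Rightarrow> real) = u t" if "0 \<le> t" for t
    using fin[OF that] bor by (auto simp: sets_rep u_def intro!: integrable_real_indicator)
  have iup: "integral\<^sup>L rep g \<le> u t" if "0 \<le> t" "g \<in> Cc" "\<And>x. 0 \<le> g x" "\<And>x. g x \<le> 1"
    "\<And>x. f x \<le> t \<Longrightarrow> g x = 0" for t g
  proof -
    have "g x \<le> indicator {x. t < f x} x" for x
      using that(4,5)[of x] by (auto simp: indicator_def)
    then show ?thesis
      using integral_mono[OF Cc_integrable[OF rep_radon that(2)] ind(1)[OF that(1)]] ind(2)[OF that(1)]
      by auto
  qed
  have ilo: "u t \<le> integral\<^sup>L rep g"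
    if "0 \<le> t" "g \<in> Cc" "\<And>x. 0 \<le> g x" "\<And>x. f x > t \<Longrightarrow> 1 \<le> g x" for t g
  proof -
    have "indicator {x. t < f x} x \<le> g x" for x
      using that(3,4)[of x] by (auto simp: indicator_def)
    then show ?thesis
      using integral_mono[OF ind(1)[OF that(1)] Cc_integrable[OF rep_radon that(2)]] ind(2)[OF that(1)]
      by auto
  qed
  have "\<bar>integral\<^sup>L rep f - \<Lambda> f\<bar> \<le> B * u 0 * inverse (real (Suc n))" for n
  proof -
    define N \<delta> where "N = Suc n" and "\<delta> = B / real (Suc n)"
    have N: "\<delta> > 0" "f x \<le> real N * \<delta>" for x
      using B(1) B(2)[of x] by (auto simp: N_def \<delta>_def)
    have s1: "\<Lambda> f \<le> (\<Sum>j<N. \<delta> * u (real j * \<delta>))" "(\<Sum>j<N. \<delta> * u (real (Suc j) * \<delta>)) \<le> \<Lambda> f"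
      by (rule slice_bounds[OF f N(2,1)]; fact \<Lambda>up \<Lambda>lo)+
    have s2: "integral\<^sup>L rep f \<le> (\<Sum>j<N. \<delta> * u (real j * \<delta>))"
      "(\<Sum>j<N. \<delta> * u (real (Suc j) * \<delta>)) \<le> integral\<^sup>L rep f"
      by (rule int.slice_bounds[OF f N(2,1)]; fact iup ilo)+
    have "(\<Sum>j<N. \<delta> * u (real j * \<delta>)) - (\<Sum>j<N. \<delta> * u (real (Suc j) * \<delta>)) =
        - (\<Sum>j<N. \<delta> * u (real (Suc j) * \<delta>) - \<delta> * u (real j * \<delta>))"
      by (simp add: sum_subtractf)
    also have "\<dots> = \<delta> * u 0 - \<delta> * u (real N * \<delta>)"
      by (subst sum_lessThan_telescope[of "\<lambda>j. \<delta> * u (real j * \<delta>)"]) simp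
    also have "\<dots> \<le> \<delta> * u 0" using N(1) by (simp add: u_def)
    finally have "\<bar>integral\<^sup>L rep f - \<Lambda> f\<bar> \<le> \<delta> * u 0" using s1 s2 by linarith
    then show ?thesis by (simp add: \<delta>_def field_simps)
  qed
  moreover have "(\<lambda>n. B * u 0 * inverse (real (Suc n))) \<longlonglongrightarrow> B * u 0 * 0"
    by (intro tendsto_mult_left LIMSEQ_inverse_real_of_nat)
  ultimately have "\<bar>integral\<^sup>L rep f - \<Lambda> f\<bar> \<le> 0"
    by (intro LIMSEQ_le_const[of "\<lambda>n. B * u 0 * inverse (real (Suc n))"]) auto
  then show ?thesis by simp
qed

theorem integral_rep:
  assumes f: "f \<in> Cc"
  shows "integral\<^sup>L rep f = \<Lambda> f"
proof -
  interpret int: positive_functional "\<lambda>f. integral\<^sup>L rep f"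
    by (rule integral_positive_functional[OF lc rep_radon])
  let ?p = "\<lambda>x. max (f x) 0" and ?m = "\<lambda>x. max (-1 * f x) 0"
  have C: "?p \<in> Cc" "?m \<in> Cc" using Cc_max_zero[OF f] Cc_max_zero[OF Cc_scale[OF f, of "-1"]] by auto
  have eq: "f = (\<lambda>x. ?p x - ?m x)" by (auto simp: max_def)
  show ?thesis
    by (subst (1 2) eq) (simp only: int.diff[OF C] diff[OF C] integral_rep_nonneg[OF C(1)] integral_rep_nonneg[OF C(2)] max.cobounded2)
qed

end

section \<open>The vague topology as a subspace of a product\<close>

text \<open>By monotone convergence the measure of a generator of the Borel sets is determined by
  integrals of functions in \<open>Cc\<close> alone, which is what uniqueness requires.\<close>

lemma emeasure_Cc_positive:
  fixes f :: "'a::t2_space \<Rightarrow> real"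
  assumes \<mu>: "\<mu> \<in> radon_measures" and f: "f \<in> Cc" "\<And>x. 0 \<le> f x"
  shows "emeasure \<mu> {x. f x > 0} = (SUP k::nat. ennreal (integral\<^sup>L \<mu> (\<lambda>x. min (real k * f x) 1)))"
proof -
  have sets: "sets \<mu> = sets borel" using \<mu> by (simp add: radon_measures_def)
  have C: "(\<lambda>x. min (real k * f x) 1) \<in> Cc" for k
    by (intro Cc_min_const Cc_scale f) simp
  have "{x. f x > 0} \<in> sets borel"
    using f(1) by (intro borel_open open_Collect_less) (auto intro: Cc_continuous)
  then have "emeasure \<mu> {x. f x > 0} = (\<integral>\<^sup>+x. indicator {x. f x > 0} x \<partial>\<mu>)"
    by (simp add: sets)
  also have "\<dots> = (\<integral>\<^sup>+x. (SUP k::nat. ennreal (min (real k * f x) 1)) \<partial>\<mu>)"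
  proof (rule nn_integral_cong)
    fix x
    show "indicator {x. f x > 0} x = (SUP k::nat. ennreal (min (real k * f x) 1))"
    proof (cases "f x > 0")
      case True
      obtain N where "1 \<le> real N * f x"
        using True reals_Archimedean3[of "f x"] by (metis less_imp_le)
      then have "1 \<le> (SUP k::nat. ennreal (min (real k * f x) 1))"
        by (intro SUP_upper2[of N]) auto
      moreover have "(SUP k::nat. ennreal (min (real k * f x) 1)) \<le> 1"
        by (intro SUP_least) (simp add: ennreal_le_1)
      ultimately have "(SUP k::nat. ennreal (min (real k * f x) 1)) = 1" by (intro antisym)
      then show ?thesis using True by simp
    next
      case False
      then have "f x = 0" using f(2)[of x] by simp
      then show ?thesis by simp
    qed
  qed
  also have "\<dots> = (SUP k::nat. \<integral>\<^sup>+x. ennreal (min (real k * f x) 1) \<partial>\<mu>)"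
  proof (rule nn_integral_monotone_convergence_SUP)
    show "incseq (\<lambda>k x. ennreal (min (real k * f x) 1))"
    proof (intro incseq_SucI le_funI ennreal_leI min.mono order.refl)
      show "real k * f x \<le> real (Suc k) * f x" for k x
        using f(2)[of x] by (intro mult_right_mono) auto
    qed
    show "(\<lambda>x. ennreal (min (real k * f x) 1)) \<in> borel_measurable \<mu>" for k
      using Cc_borel[OF C[of k]]
      by (intro measurable_compose[OF _ measurable_ennreal]) (simp cong: measurable_cong_sets add: sets)
  qed
  also have "\<dots> = (SUP k::nat. ennreal (integral\<^sup>L \<mu> (\<lambda>x. min (real k * f x) 1)))"
    using f(2) by (intro SUP_cong nn_integral_eq_integral Cc_integrable[OF \<mu> C]) auto
  finally show ?thesis .
qed

text \<open>The positivity sets form a generating pi-system, because products of test functions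
  realise intersections, and each has finite measure, being contained in a compact support.\<close>

lemma radon_measures_eqI:
  fixes \<mu> \<nu> :: "'a::{t2_space, second_countable_topology} measure"
  assumes lc: "locally_compact_space (euclidean :: 'a topology)"
    and \<mu>: "\<mu> \<in> radon_measures" and \<nu>: "\<nu> \<in> radon_measures"
    and eq: "\<And>f. f \<in> Cc \<Longrightarrow> integral\<^sup>L \<mu> f = integral\<^sup>L \<nu> f"
  shows "\<mu> = \<nu>"
proof -
  define E :: "'a set set" where "E = {{x. f x > 0} | f. f \<in> Cc \<and> (\<forall>x. 0 \<le> f x)}"
  obtain \<F> where \<F>: "countable \<F>" "\<F> \<subseteq> E" "UNIV = \<Union>\<F>"
    unfolding E_def by (rule open_eq_countable_Union_Cc_positive[OF lc open_UNIV])
  show ?thesis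
  proof (rule measure_eqI_generator_eq_countable[where E=E and A=\<F> and \<Omega>=UNIV])
    show "Int_stable E"
    proof (rule Int_stableI)
      fix S T assume "S \<in> E" "T \<in> E"
      then obtain f g where fg: "S = {x. f x > 0}" "f \<in> Cc" "\<forall>x. 0 \<le> f x"
        "T = {x. g x > 0}" "g \<in> Cc" "\<forall>x. 0 \<le> g x"
        unfolding E_def by blast
      have "S \<inter> T = {x. f x * g x > 0}"
        using fg by (auto simp: zero_less_mult_iff) (metis not_less)+
      moreover have "(\<lambda>x. f x * g x) \<in> Cc" using fg by (intro Cc_mult_continuous Cc_continuous)
      ultimately show "S \<inter> T \<in> E" unfolding E_def using fg by auto
    qed
    show "emeasure \<mu> X = emeasure \<nu> X" if "X \<in> E" for X
    proof -
      obtain f where f: "X = {x. f x > 0}" "f \<in> Cc" "\<And>x. 0 \<le> f x"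
        using \<open>X \<in> E\<close> unfolding E_def by blast
      have "(\<lambda>x. min (real k * f x) 1) \<in> Cc" for k
        by (intro Cc_min_const Cc_scale f) simp
      then show ?thesis
        unfolding f(1) by (simp add: emeasure_Cc_positive[OF _ f(2,3)] \<mu> \<nu> eq)
    qed
    show "sets \<mu> = sigma_sets UNIV E" "sets \<nu> = sigma_sets UNIV E"
      using \<mu> \<nu> borel_eq_sigma_sets_Cc_positive[OF lc] by (simp_all add: E_def radon_measures_def)
    show "emeasure \<mu> X \<noteq> \<infinity>" if "X \<in> \<F>" for X
    proof -
      obtain f where f: "X = {x. f x > 0}" "f \<in> Cc" "\<forall>x. 0 \<le> f x"
        using \<open>X \<in> \<F>\<close> \<F>(2) unfolding E_def by blast
      obtain K where K: "compact K" "\<And>x. x \<notin> K \<Longrightarrow> f x = 0"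
        using Cc_support[OF f(2)] by metis
      have "X \<subseteq> K" using K(2) f(1) by force
      moreover have "K \<in> sets \<mu>"
        using \<mu> K(1) by (simp add: radon_measures_def borel_closed compact_imp_closed)
      ultimately have "emeasure \<mu> X \<le> emeasure \<mu> K" by (intro emeasure_mono)
      also have "\<dots> < \<infinity>" using \<mu> K(1) by (simp add: radon_measures_def)
      finally show ?thesis by simp
    qed
  qed (use \<F> in auto)
qed

text \<open>Restriction to \<open>Cc\<close> makes the value extensional, hence a point of
  \<open>Cc_product\<close>.\<close>

definition Cc_eval :: "'a::topological_space measure \<Rightarrow> ('a \<Rightarrow> real) \<Rightarrow> real" where
  "Cc_eval \<mu> = restrict (\<lambda>f. integral\<^sup>L \<mu> f) Cc"

abbreviation Cc_product :: "(('a::topological_space \<Rightarrow> real) \<Rightarrow> real) topology" where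
  "Cc_product \<equiv> product_topology (\<lambda>_. euclideanreal) Cc"

lemma topspace_vague: "topspace vague_topology = (radon_measures :: 'a::topological_space measure set)"
proof -
  have "radon_measures \<in> {{\<mu> \<in> radon_measures. integral\<^sup>L \<mu> f \<in> U} | (f :: 'a \<Rightarrow> real) U. f \<in> Cc \<and> open U}"
    by (rule CollectI, intro exI[of _ "\<lambda>_. 0"] exI[of _ UNIV]) (simp add: Cc_zero)
  then show ?thesis
    unfolding vague_topology_def topology_generated_by_topspace by blast
qed

lemma continuous_map_vague_integral:
  assumes "f \<in> Cc"
  shows "continuous_map vague_topology euclideanreal (\<lambda>\<mu>. integral\<^sup>L \<mu> f)"
proof -
  have "openin vague_topology {\<mu> \<in> radon_measures. integral\<^sup>L \<mu> f \<in> U}" if "open U" for U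
    unfolding vague_topology_def using assms that by (intro topology_generated_by_Basis) blast
  then show ?thesis
    by (simp add: continuous_map_def topspace_vague)
qed

lemma continuous_map_Cc_eval: "continuous_map vague_topology Cc_product Cc_eval"
  unfolding continuous_map_componentwise
  by (auto simp: Cc_eval_def continuous_map_vague_integral)

lemma continuous_map_fdvec:
  assumes "\<forall>i<m. fs i \<in> Cc"
  shows "continuous_map vague_topology (Rm_topology m) (fdvec m fs)"
  unfolding continuous_map_componentwise
  using assms by (auto simp: fdvec_def continuous_map_vague_integral)

text \<open>Every vaguely open set is thus a full preimage of an open set of the product, so
  closedness and compactness can be treated there, where Tychonoff's theorem is available.\<close>

lemma vague_topology_eq_pullback:
  "vague_topology = pullback_topology radon_measures Cc_eval Cc_product"
proof (rule topology_eq[THEN iffD2], intro allI iffI)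
  fix S :: "'a measure set"
  assume "openin vague_topology S"
  then have "generate_topology_on {{\<mu> \<in> radon_measures. integral\<^sup>L \<mu> f \<in> U} | f U. f \<in> Cc \<and> open U} S"
    unfolding vague_topology_def openin_topology_generated_by_iff .
  then show "openin (pullback_topology radon_measures Cc_eval Cc_product) S"
  proof (rule generate_topology_on_coarsest[OF istopology_openin, rotated])
    fix T :: "'a measure set"
    assume "T \<in> {{\<mu> \<in> radon_measures. integral\<^sup>L \<mu> f \<in> U} | f U. f \<in> Cc \<and> open U}"
    then obtain f :: "'a \<Rightarrow> real" and U where fU: "T = {\<mu> \<in> radon_measures. integral\<^sup>L \<mu> f \<in> U}" "f \<in> Cc" "open U"
      by blast
    have "openin Cc_product {z \<in> topspace Cc_product. z f \<in> U}"
      using fU by (intro openin_continuous_map_preimage[OF continuous_map_product_projection]) auto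
    moreover have "T = Cc_eval -` {z \<in> topspace Cc_product. z f \<in> U} \<inter> radon_measures"
      using fU by (auto simp: Cc_eval_def)
    ultimately show "openin (pullback_topology radon_measures Cc_eval Cc_product) T"
      unfolding openin_pullback_topology by blast
  qed
next
  fix S :: "'a measure set"
  assume "openin (pullback_topology radon_measures Cc_eval Cc_product) S"
  then obtain W where W: "openin Cc_product W" "S = Cc_eval -` W \<inter> radon_measures"
    unfolding openin_pullback_topology by blast
  have "S = {\<mu> \<in> topspace vague_topology. Cc_eval \<mu> \<in> W}"
    using W by (auto simp: topspace_vague)
  then show "openin vague_topology S"
    using openin_continuous_map_preimage[OF continuous_map_Cc_eval W(1)] by simp
qed

lemma openin_vague_iff:
  "openin vague_topology G \<longleftrightarrow> (\<exists>W. openin Cc_product W \<and> G = {\<mu> \<in> radon_measures. Cc_eval \<mu> \<in> W})"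
  unfolding vague_topology_eq_pullback openin_pullback_topology by (auto simp: vimage_def Int_def conj_commute)

lemma closedin_vagueE:
  assumes "closedin vague_topology F"
  obtains C where "closedin Cc_product C" "F = {\<mu> \<in> radon_measures. Cc_eval \<mu> \<in> C}"
proof -
  have F: "F \<subseteq> radon_measures" "openin vague_topology (radon_measures - F)"
    using assms by (auto simp: closedin_def topspace_vague)
  then obtain W where W: "openin Cc_product W" "radon_measures - F = {\<mu> \<in> radon_measures. Cc_eval \<mu> \<in> W}"
    unfolding openin_vague_iff by blast
  have "Cc_eval \<mu> \<in> topspace Cc_product" for \<mu> :: "'a measure"
    by (simp add: Cc_eval_def)
  then have "F = {\<mu> \<in> radon_measures. Cc_eval \<mu> \<in> topspace Cc_product - W}"
    using F(1) W(2) by blast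
  moreover have "closedin Cc_product (topspace Cc_product - W)"
    using W(1) by (rule closedin_diff[OF closedin_topspace])
  ultimately show ?thesis by (rule that[rotated])
qed

text \<open>Since vaguely open sets are full preimages, a cover of \<open>S\<close> transports to
  its image, and a finite subcover found there pulls back.\<close>

lemma compactin_vagueI:
  assumes S: "S \<subseteq> radon_measures" and c: "compactin Cc_product (Cc_eval ` S)"
  shows "compactin vague_topology S"
  unfolding compactin_def
proof (intro conjI allI impI)
  show "S \<subseteq> topspace vague_topology" using S by (simp add: topspace_vague)
  fix \<U> :: "'a measure set set"
  assume \<U>: "Ball \<U> (openin vague_topology) \<and> S \<subseteq> \<Union>\<U>"
  then have "\<forall>G\<in>\<U>. \<exists>W. openin Cc_product W \<and> G = {\<mu> \<in> radon_measures. Cc_eval \<mu> \<in> W}"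
    unfolding openin_vague_iff by blast
  then obtain W where W: "\<And>G. G \<in> \<U> \<Longrightarrow> openin Cc_product (W G)"
    "\<And>G. G \<in> \<U> \<Longrightarrow> G = {\<mu> \<in> radon_measures. Cc_eval \<mu> \<in> W G}"
    by metis
  have "Cc_eval ` S \<subseteq> \<Union>(W ` \<U>)" using \<U> W(2) by blast
  then obtain \<V> where \<V>: "finite \<V>" "\<V> \<subseteq> W ` \<U>" "Cc_eval ` S \<subseteq> \<Union>\<V>"
    using c[unfolded compactin_def, THEN conjunct2, rule_format, of "W ` \<U>"] W(1) by auto
  then obtain \<G> where \<G>: "\<G> \<subseteq> \<U>" "finite \<G>" "\<V> = W ` \<G>"
    by (meson finite_subset_image)
  have "S \<subseteq> \<Union>\<G>" using \<V>(3) \<G> W(2) S by blast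
  then show "\<exists>\<F>. finite \<F> \<and> \<F> \<subseteq> \<U> \<and> S \<subseteq> \<Union>\<F>" using \<G> by blast
qed

lemma closedin_Collect_Ball:
  assumes "\<And>i. i \<in> A \<Longrightarrow> closedin X {x \<in> topspace X. P i x}"
  shows "closedin X {x \<in> topspace X. \<forall>i\<in>A. P i x}"
proof (cases "A = {}")
  case False
  then have "{x \<in> topspace X. \<forall>i\<in>A. P i x} = (\<Inter>i\<in>A. {x \<in> topspace X. P i x})" by auto
  then show ?thesis using assms False by auto
qed simp

text \<open>The inclusion from right to left is Riesz: \<open>z\<close> itself instantiates
  \<open>positive_functional\<close>, and \<open>rep\<close> is the required measure. Each condition
  is quantified over a single set, the form handled by \<open>closedin_Collect_Ball\<close>.\<close>

lemma Cc_eval_radon_eq: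
  assumes lc: "locally_compact_space (euclidean :: 'a::{t2_space, second_countable_topology} topology)"
  shows "Cc_eval ` (radon_measures :: 'a measure set) = {z \<in> topspace Cc_product.
     (\<forall>(f, g)\<in>Cc \<times> Cc. z (\<lambda>x. f x + g x) = z f + z g) \<and>
     (\<forall>(c, f)\<in>UNIV \<times> Cc. z (\<lambda>x. c * f x) = c * z f) \<and>
     (\<forall>f\<in>{f \<in> Cc. \<forall>x. 0 \<le> f x}. 0 \<le> z f)}" (is "_ = ?L")
proof
  show "Cc_eval ` radon_measures \<subseteq> ?L"
  proof
    fix z assume "z \<in> Cc_eval ` (radon_measures :: 'a measure set)"
    then obtain \<mu> :: "'a measure" where \<mu>: "\<mu> \<in> radon_measures" "z = Cc_eval \<mu>" by blast
    interpret positive_functional "\<lambda>f. integral\<^sup>L \<mu> f"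
      by (rule integral_positive_functional[OF lc \<mu>(1)])
    have zf: "z f = integral\<^sup>L \<mu> f" if "f \<in> Cc" for f using that \<mu>(2) by (simp add: Cc_eval_def)
    have "z (\<lambda>x. f x + g x) = z f + z g" if "f \<in> Cc" "g \<in> Cc" for f g
      using that add[OF that] by (simp only: zf Cc_add)
    moreover have "z (\<lambda>x. c * f x) = c * z f" if "f \<in> Cc" for f c
      using that scale[OF that] by (simp only: zf Cc_scale)
    moreover have "0 \<le> z f" if "f \<in> Cc" "\<forall>x. 0 \<le> f x" for f
      using that pos[of f] by (simp only: zf)
    moreover have "z \<in> topspace Cc_product" by (simp add: \<mu>(2) Cc_eval_def)
    ultimately show "z \<in> ?L" by blast
  qed
  show "?L \<subseteq> Cc_eval ` radon_measures"
  proof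
    fix z assume z: "z \<in> ?L"
    then interpret positive_functional z
      by unfold_locales (use lc in auto)
    have "z = Cc_eval rep"
      using z integral_rep by (auto simp: Cc_eval_def PiE_def extensional_def)
    then show "z \<in> Cc_eval ` radon_measures" using rep_radon by blast
  qed
qed

text \<open>By the Riesz representation, the Radon measures are exactly the positive linear functionals,
  a closed condition on \<open>\<real>\<close>-valued functions on \<open>Cc\<close>.\<close>
lemma closedin_Cc_eval_radon:
  assumes lc: "locally_compact_space (euclidean :: 'a::{t2_space, second_countable_topology} topology)"
  shows "closedin Cc_product (Cc_eval ` (radon_measures :: 'a measure set))"
proof -
  have proj: "continuous_map Cc_product euclideanreal (\<lambda>z. z f)" if "f \<in> Cc" for f :: "'a \<Rightarrow> real"
    using that continuous_map_product_projection[of f Cc "\<lambda>_. euclideanreal"] by simp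
  have eq0: "closedin Cc_product {z \<in> topspace Cc_product. p z = q z}"
    if "continuous_map Cc_product euclideanreal p" "continuous_map Cc_product euclideanreal q"
    for p q :: "(('a \<Rightarrow> real) \<Rightarrow> real) \<Rightarrow> real"
    using closedin_continuous_map_preimage[OF continuous_map_diff[OF that], of "{0}"] by simp
  have 1: "closedin Cc_product {z \<in> topspace Cc_product.
      \<forall>p\<in>Cc \<times> Cc. case p of (f, g) \<Rightarrow> z (\<lambda>x. f x + g x) = z f + z (g :: 'a \<Rightarrow> real)}"
    by (rule closedin_Collect_Ball, clarify, rule eq0) (auto intro!: continuous_map_add proj Cc_add)
  have 2: "closedin Cc_product {z \<in> topspace Cc_product.
      \<forall>p\<in>UNIV \<times> Cc. case p of (c, f) \<Rightarrow> z (\<lambda>x. c * f x) = c * z (f :: 'a \<Rightarrow> real)}"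
    by (rule closedin_Collect_Ball, clarify, rule eq0)
      (auto intro!: continuous_map_real_mult_left proj Cc_scale)
  have 3: "closedin Cc_product {z \<in> topspace Cc_product. \<forall>f\<in>{f \<in> Cc. \<forall>x. 0 \<le> f x}. 0 \<le> z (f :: 'a \<Rightarrow> real)}"
  proof (rule closedin_Collect_Ball)
    fix f :: "'a \<Rightarrow> real" assume "f \<in> {f \<in> Cc. \<forall>x. 0 \<le> f x}"
    then show "closedin Cc_product {z \<in> topspace Cc_product. 0 \<le> z f}"
      using closedin_continuous_map_preimage[OF proj[of f], of "{0..}"] by simp
  qed
  show ?thesis
    unfolding Cc_eval_radon_eq[OF lc]
    using closedin_Int[OF closedin_Int[OF 1 2] 3] by (rule back_subst[of "closedin Cc_product"]) auto
qed

section \<open>The projective limit principle\<close>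

text \<open>Comparison with \<open>exp (a * s)\<close> in \<open>ennreal\<close> turns rate
  estimates into estimates of probabilities and expectations, with the arguments \<open>0\<close>
  and \<open>\<top>\<close> included.\<close>

lemma scaled_eln_le_iff:
  assumes "a > 0"
  shows "ereal (1 / a) * eln x \<le> ereal s \<longleftrightarrow> x \<le> ennreal (exp (a * s))"
proof (cases x)
  case (real r)
  show ?thesis
  proof (cases "r = 0")
    case True
    then show ?thesis using assms real by (simp add: eln_def)
  next
    case False
    then have "eln x = ereal (ln r)" using real by (simp add: eln_def)
    moreover have "ln r / a \<le> s \<longleftrightarrow> r \<le> exp (a * s)"
      using assms False real
      by (metis divide_le_eq exp_gt_zero ln_exp ln_le_cancel_iff mult.commute order_le_imp_less_or_eq)
    ultimately show ?thesis using real by (simp add: ennreal_le_iff)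
  qed
next
  case top
  then show ?thesis using assms by (simp add: eln_def top_unique)
qed

lemma scaled_eln_less_iff:
  assumes "a > 0"
  shows "ereal s < ereal (1 / a) * eln x \<longleftrightarrow> ennreal (exp (a * s)) < x"
  using scaled_eln_le_iff[OF assms, of x s] by (metis not_le)

lemma scaled_eln_ge_iff:
  assumes "a > 0"
  shows "ereal s \<le> ereal (1 / a) * eln x \<longleftrightarrow> ennreal (exp (a * s)) \<le> x"
proof (cases x)
  case (real r)
  show ?thesis
  proof (cases "r = 0")
    case True
    then show ?thesis using assms real by (simp add: eln_def not_le)
  next
    case False
    then have "eln x = ereal (ln r)" using real by (simp add: eln_def)
    moreover have "s \<le> ln r / a \<longleftrightarrow> exp (a * s) \<le> r"
      using assms False real
      by (metis le_divide_eq exp_gt_zero ln_exp ln_le_cancel_iff mult.commute order_le_imp_less_or_eq)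
    ultimately show ?thesis using real by (simp add: ennreal_le_iff)
  qed
next
  case top
  then show ?thesis using assms by (simp add: eln_def)
qed

lemma scaled_eln_mono:
  assumes "a > 0" "x \<le> y"
  shows "ereal (1 / a) * eln x \<le> ereal (1 / a) * eln y"
proof (rule ereal_le_real)
  fix s assume "ereal (1 / a) * eln y \<le> ereal s"
  then show "ereal (1 / a) * eln x \<le> ereal s"
    using assms by (simp add: scaled_eln_le_iff order_trans)
qed

lemma ldp_openD:
  assumes "ldp X M Z a J" "openin X G" "x \<in> G"
  shows "- J x \<le> liminf (\<lambda>n. ereal (1 / a n) * eln (pr M Z n G))"
proof -
  have "- J x \<le> - (INF x\<in>G. J x)" using assms(3) by (simp add: INF_lower)
  also have "\<dots> \<le> liminf (\<lambda>n. ereal (1 / a n) * eln (pr M Z n G))"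
    using assms(1,2) unfolding ldp_def by blast
  finally show ?thesis .
qed

lemma ldp_closedD:
  assumes "ldp X M Z a J" "closedin X F" "\<And>x. x \<in> F \<Longrightarrow> c \<le> J x"
  shows "limsup (\<lambda>n. ereal (1 / a n) * eln (pr M Z n F)) \<le> - c"
proof -
  have "limsup (\<lambda>n. ereal (1 / a n) * eln (pr M Z n F)) \<le> - (INF x\<in>F. J x)"
    using assms(1,2) unfolding ldp_def by blast
  also have "\<dots> \<le> - c" using assms(3) by (simp add: INF_greatest)
  finally show ?thesis .
qed

text \<open>The half of the contraction principle that needs no compactness.\<close>
lemma ldp_contraction_le:
  assumes X: "ldp X M Z a J" and Y: "ldp Y M Z' a J'"
    and T: "continuous_map X Y T" and reg: "regular_space Y" and a: "\<And>n. a n > 0"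
    and Z: "\<And>n \<omega>. \<omega> \<in> space (M n) \<Longrightarrow> Z' n \<omega> = T (Z n \<omega>)"
    and m: "\<And>n C. closedin Y C \<Longrightarrow> {\<omega> \<in> space (M n). Z' n \<omega> \<in> C} \<in> sets (M n)"
    and x: "x \<in> topspace X"
  shows "J' (T x) \<le> J x"
proof (rule dense_le)
  fix c assume c: "c < J' (T x)"
  have "closedin Y {y \<in> topspace Y. J' y \<le> c}"
    using Y by (simp add: ldp_def rate_function_def)
  then have "openin Y (topspace Y - {y \<in> topspace Y. J' y \<le> c})" (is "openin Y ?W") by blast
  moreover have "T x \<in> ?W" using c x continuous_map_image_subset_topspace[OF T] by auto
  \<comment> \<open>Regularity puts a closed \<open>V\<close> between a neighbourhood of
    \<open>T x\<close> and \<open>{J' > c}\<close>: the lower bound in \<open>X\<close> needs an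
    open set, the upper bound in \<open>Y\<close> a closed one.\<close>
  ultimately obtain U V where UV: "openin Y U" "closedin Y V" "T x \<in> U" "U \<subseteq> V" "V \<subseteq> ?W"
    using reg[folded neighbourhood_base_of_closedin, unfolded neighbourhood_base_of, rule_format, of ?W "T x"]
    by blast
  define G where "G = {y \<in> topspace X. T y \<in> U}"
  have G: "openin X G" "x \<in> G"
    using openin_continuous_map_preimage[OF T UV(1)] x UV(3) by (auto simp: G_def)
  have "pr M Z n G \<le> pr M Z' n V" for n
    unfolding pr_def using Z UV(4) by (intro emeasure_mono m UV(2)) (auto simp: G_def)
  then have le: "ereal (1 / a n) * eln (pr M Z n G) \<le> ereal (1 / a n) * eln (pr M Z' n V)" for n
    by (intro scaled_eln_mono a)
  have "- J x \<le> liminf (\<lambda>n. ereal (1 / a n) * eln (pr M Z n G))"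
    by (rule ldp_openD[OF X G])
  also have "\<dots> \<le> limsup (\<lambda>n. ereal (1 / a n) * eln (pr M Z n G))"
    by (rule Liminf_le_Limsup) simp
  also have "\<dots> \<le> limsup (\<lambda>n. ereal (1 / a n) * eln (pr M Z' n V))"
    by (intro Limsup_mono always_eventually allI le)
  also have "\<dots> \<le> - c"
    using UV(5) by (intro ldp_closedD[OF Y UV(2)]) auto
  finally show "c \<le> J x" by simp
qed

lemma regular_space_Rm: "regular_space (Rm_topology m)"
  by (simp add: regular_space_product_topology metrizable_imp_regular_space metrizable_space_euclidean)

section \<open>Finite-dimensional coordinates on the product\<close>

definition test_tuples :: "(nat \<times> (nat \<Rightarrow> 'a::topological_space \<Rightarrow> real)) set" where
  "test_tuples = {(m, fs). 1 \<le> m \<and> (\<forall>i<m. fs i \<in> Cc)}"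

text \<open>The counterpart of \<open>fdvec\<close> for arbitrary points of the product, including
  those not yet known to come from a measure.\<close>

definition coords :: "nat \<Rightarrow> (nat \<Rightarrow> 'a \<Rightarrow> real) \<Rightarrow> (('a \<Rightarrow> real) \<Rightarrow> real) \<Rightarrow> nat \<Rightarrow> real" where
  "coords m fs z = restrict (\<lambda>i. z (fs i)) {..<m}"

lemma coords_Cc_eval:
  assumes "\<forall>i<m. fs i \<in> Cc"
  shows "coords m fs (Cc_eval \<mu>) = fdvec m fs \<mu>"
  using assms by (auto simp: coords_def Cc_eval_def fdvec_def)

lemma continuous_map_coords:
  assumes "\<forall>i<m. fs i \<in> Cc"
  shows "continuous_map Cc_product (Rm_topology m) (coords m fs)"
  unfolding continuous_map_componentwise
proof (intro conjI ballI)
  fix k assume k: "k \<in> {..<m}"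
  then have "continuous_map Cc_product euclideanreal (\<lambda>z. z (fs k))"
    using assms continuous_map_product_projection[of "fs k" Cc "\<lambda>_. euclideanreal"] by simp
  then show "continuous_map Cc_product euclideanreal (\<lambda>z. coords m fs z k)"
    using k by (simp add: coords_def)
qed (auto simp: coords_def)

text \<open>Inserting the zero function keeps the tuple nonempty even for empty \<open>S\<close>, as
  \<open>test_tuples\<close> demands \<open>1 \<le> m\<close>.\<close>

lemma enumerate_test_functions:
  assumes "finite S" "S \<subseteq> (Cc :: ('a::topological_space \<Rightarrow> real) set)"
  obtains m fs where "(m, fs) \<in> test_tuples" "S \<subseteq> fs ` {..<m}"
proof -
  let ?S = "insert (\<lambda>x. 0) S"
  obtain fs where fs: "bij_betw fs {0..<card ?S} ?S"
    using ex_bij_betw_nat_finite[of ?S] assms(1) by auto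
  show ?thesis
  proof
    have "fs i \<in> Cc" if "i < card ?S" for i
    proof -
      have "fs i \<in> ?S" using fs that by (auto simp: bij_betw_def atLeast0LessThan)
      then show ?thesis using assms(2) by (auto simp: Cc_zero)
    qed
    moreover have "1 \<le> card ?S" using assms(1) by (simp add: Suc_le_eq card_gt_0_iff)
    ultimately show "(card ?S, fs) \<in> test_tuples" unfolding test_tuples_def by blast
    show "S \<subseteq> fs ` {..<card ?S}"
      using fs by (auto simp: bij_betw_def atLeast0LessThan)
  qed
qed

text \<open>A basic open set of the product constrains finitely many coordinates only; listing these
  as one tuple reduces it to a finite-dimensional open set.\<close>

lemma Cc_product_neighbourhood:
  assumes W: "openin Cc_product W" "z \<in> W"
  obtains m fs U where "(m, fs) \<in> test_tuples" "openin (Rm_topology m) U" "coords m fs z \<in> U"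
    "\<And>z'. z' \<in> topspace Cc_product \<Longrightarrow> coords m fs z' \<in> U \<Longrightarrow> z' \<in> W"
proof -
  obtain X where X: "z \<in> (\<Pi>\<^sub>E f\<in>Cc. X f)" "\<And>f. open (X f)" "finite {f. X f \<noteq> UNIV}"
      "(\<Pi>\<^sub>E f\<in>Cc. X f) \<subseteq> W"
    using product_topology_open_contains_basis[OF W] by auto
  obtain m fs where fs: "(m, fs) \<in> test_tuples" "{f. X f \<noteq> UNIV} \<inter> Cc \<subseteq> fs ` {..<m}"
    by (rule enumerate_test_functions[of "{f. X f \<noteq> UNIV} \<inter> Cc"]) (use X(3) in auto)
  define U where "U = (\<Pi>\<^sub>E i\<in>{..<m}. X (fs i))"
  show ?thesis
  proof
    show "openin (Rm_topology m) U"
      unfolding U_def using X(2) by (simp add: openin_PiE_gen)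
    show "coords m fs z \<in> U"
      using X(1) fs(1) by (auto simp: U_def coords_def test_tuples_def)
    fix z' assume z': "z' \<in> topspace Cc_product" "coords m fs z' \<in> U"
    have "z' f \<in> X f" if f: "f \<in> Cc" for f
    proof (cases "X f = UNIV")
      case False
      then obtain i where "i < m" "f = fs i" using fs(2) f by blast
      then show ?thesis using z'(2) by (auto simp: U_def coords_def PiE_iff)
    qed simp
    then have "z' \<in> (\<Pi>\<^sub>E f\<in>Cc. X f)" using z'(1) by (auto simp: PiE_iff)
    then show "z' \<in> W" using X(4) by blast
  qed (rule fs(1))
qed

section \<open>The process, its marginals and their compatibility\<close>

locale vague_ldp =
  fixes M :: "nat \<Rightarrow> 'w measure"
    and \<xi> :: "nat \<Rightarrow> 'w \<Rightarrow> 'a::{t2_space, second_countable_topology} measure"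
    and a :: "nat \<Rightarrow> real"
    and J :: "nat \<Rightarrow> (nat \<Rightarrow> 'a \<Rightarrow> real) \<Rightarrow> (nat \<Rightarrow> real) \<Rightarrow> ereal"
    and I :: "'a measure \<Rightarrow> ereal"
  assumes lc: "locally_compact_space (euclidean :: 'a topology)"
    and a_pos: "\<And>n. a n > 0"
    and a_lim: "filterlim a at_top sequentially"
    and prob: "\<And>n. prob_space (M n)"
    and meas: "\<And>n. \<xi> n \<in> measurable (M n) (borel_of_top vague_topology)"
    and fd_ldp: "\<And>m fs. m \<ge> 1 \<Longrightarrow> (\<forall>i<m. fs i \<in> Cc) \<Longrightarrow>
        ldp (Rm_topology m) M (\<lambda>n \<omega>. fdvec m fs (\<xi> n \<omega>)) a (J m fs) \<and>
        good_rate_function (Rm_topology m) (J m fs)"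
    and I_def: "\<And>\<mu>. I \<mu> = (SUP m\<in>{1..}. SUP fs\<in>{fs. \<forall>i<m. fs i \<in> Cc}. J m fs (fdvec m fs \<mu>))"
begin

lemma tuple_ldp:
  assumes "(m, fs) \<in> test_tuples"
  shows "ldp (Rm_topology m) M (\<lambda>n \<omega>. fdvec m fs (\<xi> n \<omega>)) a (J m fs)"
    and "good_rate_function (Rm_topology m) (J m fs)"
  using fd_ldp[of m fs] assms by (auto simp: test_tuples_def)

lemma J_nonneg:
  assumes "(m, fs) \<in> test_tuples" "x \<in> topspace (Rm_topology m)"
  shows "0 \<le> J m fs x"
  using tuple_ldp(2)[OF assms(1)] assms(2) by (simp add: good_rate_function_def rate_function_def)

lemma closedin_J_le:
  assumes "(m, fs) \<in> test_tuples"
  shows "closedin (Rm_topology m) {x \<in> topspace (Rm_topology m). J m fs x \<le> c}"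
  using tuple_ldp(2)[OF assms(1)] by (simp add: good_rate_function_def rate_function_def)

lemma space_borel_of_vague: "space (borel_of_top vague_topology) = (radon_measures :: 'a measure set)"
  unfolding borel_of_top_def by (simp add: topspace_vague space_measure_of_conv)

lemma xi_radon: "\<omega> \<in> space (M n) \<Longrightarrow> \<xi> n \<omega> \<in> radon_measures"
  using measurable_space[OF meas] space_borel_of_vague by auto

lemma sets_open:
  assumes "openin vague_topology G"
  shows "{\<omega> \<in> space (M n). \<xi> n \<omega> \<in> G} \<in> sets (M n)"
proof -
  have "G \<in> sets (borel_of_top vague_topology)"
    unfolding borel_of_top_def using assms by (subst sets_measure_of) (auto dest: openin_subset)
  from measurable_sets[OF meas this, of n] show ?thesis
    by (simp add: vimage_def Int_def conj_commute)
qed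

lemma sets_closed:
  assumes F: "closedin vague_topology F"
  shows "{\<omega> \<in> space (M n). \<xi> n \<omega> \<in> F} \<in> sets (M n)"
proof -
  have "{\<omega> \<in> space (M n). \<xi> n \<omega> \<in> F} =
      space (M n) - {\<omega> \<in> space (M n). \<xi> n \<omega> \<in> topspace vague_topology - F}"
    using xi_radon by (auto simp: topspace_vague)
  also have "\<dots> \<in> sets (M n)"
    using F by (intro sets.compl_sets sets_open) auto
  finally show ?thesis .
qed

lemma sets_fdvec_closed:
  assumes fs: "(m, fs) \<in> test_tuples" and C: "closedin (Rm_topology m) C"
  shows "{\<omega> \<in> space (M n). fdvec m fs (\<xi> n \<omega>) \<in> C} \<in> sets (M n)"
proof -
  have "{\<omega> \<in> space (M n). fdvec m fs (\<xi> n \<omega>) \<in> C} =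
      {\<omega> \<in> space (M n). \<xi> n \<omega> \<in> {\<mu> \<in> topspace vague_topology. fdvec m fs \<mu> \<in> C}}"
    using xi_radon by (auto simp: topspace_vague)
  also have "\<dots> \<in> sets (M n)"
    using fs by (intro sets_closed closedin_continuous_map_preimage[OF continuous_map_fdvec C])
      (auto simp: test_tuples_def)
  finally show ?thesis .
qed

text \<open>Selecting coordinates is continuous, so contraction forces this compatibility between
  the rate functions of different tuples. \<open>\<sigma>\<close> may be any index map, which covers
  subtuples, permutations and repetitions.\<close>

lemma J_reindex_le:
  assumes fs: "(m, fs) \<in> test_tuples" and gs: "(k, gs) \<in> test_tuples"
    and \<sigma>: "\<And>i. i < k \<Longrightarrow> \<sigma> i < m \<and> gs i = fs (\<sigma> i)"
    and x: "x \<in> topspace (Rm_topology m)"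
  shows "continuous_map (Rm_topology m) (Rm_topology k) (\<lambda>x. restrict (\<lambda>i. x (\<sigma> i)) {..<k})"
    and "J k gs (restrict (\<lambda>i. x (\<sigma> i)) {..<k}) \<le> J m fs x"
proof -
  show cont: "continuous_map (Rm_topology m) (Rm_topology k) (\<lambda>x. restrict (\<lambda>i. x (\<sigma> i)) {..<k})"
    unfolding continuous_map_componentwise
  proof (intro conjI ballI)
    fix i assume i: "i \<in> {..<k}"
    then have "continuous_map (Rm_topology m) euclideanreal (\<lambda>x. x (\<sigma> i))"
      using \<sigma>[of i] continuous_map_product_projection[of "\<sigma> i" "{..<m}" "\<lambda>_. euclideanreal"] by simp
    then show "continuous_map (Rm_topology m) euclideanreal (\<lambda>x. restrict (\<lambda>i. x (\<sigma> i)) {..<k} i)"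
      using i by simp
  qed auto
  show "J k gs (restrict (\<lambda>i. x (\<sigma> i)) {..<k}) \<le> J m fs x"
    by (rule ldp_contraction_le[OF tuple_ldp(1)[OF fs] tuple_ldp(1)[OF gs] cont regular_space_Rm a_pos
        _ sets_fdvec_closed[OF gs] x])
      (auto simp: fdvec_def \<sigma>)
qed

text \<open>The sublevel sets of \<open>I\<close> with measures replaced by all points of the
  product, so that closedness can be shown before asking which points are measures.\<close>

definition levels :: "ereal \<Rightarrow> (('a \<Rightarrow> real) \<Rightarrow> real) set" where
  "levels c = {z \<in> topspace Cc_product. \<forall>(m, fs)\<in>test_tuples. J m fs (coords m fs z) \<le> c}"

lemma I_le_iff:
  assumes "\<mu> \<in> radon_measures"
  shows "I \<mu> \<le> c \<longleftrightarrow> Cc_eval \<mu> \<in> levels c"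
proof -
  have "I \<mu> \<le> c \<longleftrightarrow> (\<forall>(m, fs)\<in>test_tuples. J m fs (fdvec m fs \<mu>) \<le> c)"
    unfolding I_def by (auto simp: SUP_le_iff test_tuples_def)
  also have "\<dots> \<longleftrightarrow> (\<forall>(m, fs)\<in>test_tuples. J m fs (coords m fs (Cc_eval \<mu>)) \<le> c)"
    by (auto simp: coords_Cc_eval test_tuples_def)
  also have "\<dots> \<longleftrightarrow> Cc_eval \<mu> \<in> levels c" by (auto simp: levels_def Cc_eval_def)
  finally show ?thesis .
qed

lemma J_le_I:
  assumes "(m, fs) \<in> test_tuples"
  shows "J m fs (fdvec m fs \<mu>) \<le> I \<mu>"
  unfolding I_def using assms by (intro SUP_upper2[of m] SUP_upper) (auto simp: test_tuples_def)

lemma closedin_levels: "closedin Cc_product (levels c)"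
  unfolding levels_def
proof (rule closedin_Collect_Ball, clarify)
  fix m and fs :: "nat \<Rightarrow> 'a \<Rightarrow> real" assume fs: "(m, fs) \<in> test_tuples"
  then have cont: "continuous_map Cc_product (Rm_topology m) (coords m fs)"
    by (intro continuous_map_coords) (simp add: test_tuples_def)
  have "{z \<in> topspace Cc_product. J m fs (coords m fs z) \<le> c} =
      {z \<in> topspace Cc_product. coords m fs z \<in> {x \<in> topspace (Rm_topology m). J m fs x \<le> c}}"
    by (auto simp: coords_def)
  then show "closedin Cc_product {z \<in> topspace Cc_product. J m fs (coords m fs z) \<le> c}"
    using closedin_continuous_map_preimage[OF cont closedin_J_le[OF fs, of c]] by simp
qed

text \<open>Goodness in dimension one bounds each coordinate of \<open>levels\<close> and so
  supplies the edges of the Tychonoff box. It plays the role of exponential tightness.\<close>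

lemma J_single_bound:
  assumes f: "f \<in> Cc"
  shows "\<exists>B\<ge>0. \<forall>x\<in>topspace (Rm_topology 1). J 1 (\<lambda>_. f) x \<le> ereal c \<longrightarrow> \<bar>x 0\<bar> \<le> B"
proof -
  have "(1, \<lambda>_. f) \<in> test_tuples" using f by (simp add: test_tuples_def)
  then have "compactin (Rm_topology 1) {x \<in> topspace (Rm_topology 1). J 1 (\<lambda>_. f) x \<le> ereal c}"
    using tuple_ldp(2) unfolding good_rate_function_def by blast
  then have "compactin euclideanreal ((\<lambda>x. x 0) ` {x \<in> topspace (Rm_topology 1). J 1 (\<lambda>_. f) x \<le> ereal c})"
    by (rule image_compactin) (rule continuous_map_product_projection, simp)
  then have "bounded ((\<lambda>x. x 0) ` {x \<in> topspace (Rm_topology 1). J 1 (\<lambda>_. f) x \<le> ereal c})"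
    by (simp add: compact_imp_bounded)
  then obtain B where B: "\<bar>x 0\<bar> \<le> B" if "x \<in> topspace (Rm_topology 1)" "J 1 (\<lambda>_. f) x \<le> ereal c" for x
    unfolding bounded_iff by auto
  show ?thesis
  proof (intro exI[of _ "max B 0"] conjI ballI impI)
    fix x assume "x \<in> topspace (Rm_topology 1)" "J 1 (\<lambda>_. f) x \<le> ereal c"
    from B[OF this] show "\<bar>x 0\<bar> \<le> max B 0" by simp
  qed simp
qed

definition box_bound :: "real \<Rightarrow> ('a \<Rightarrow> real) \<Rightarrow> real" where
  "box_bound c f = (SOME B. 0 \<le> B \<and> (\<forall>x\<in>topspace (Rm_topology 1). J 1 (\<lambda>_. f) x \<le> ereal c \<longrightarrow> \<bar>x 0\<bar> \<le> B))"

lemma box_bound: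
  assumes "f \<in> Cc"
  shows "0 \<le> box_bound c f"
    and "x \<in> topspace (Rm_topology 1) \<Longrightarrow> J 1 (\<lambda>_. f) x \<le> ereal c \<Longrightarrow> \<bar>x 0\<bar> \<le> box_bound c f"
  using someI_ex[OF J_single_bound[OF assms, of c, unfolded Bex_def]]
  unfolding box_bound_def by auto

definition box :: "real \<Rightarrow> (('a \<Rightarrow> real) \<Rightarrow> real) set" where
  "box c = (\<Pi>\<^sub>E f\<in>Cc. {- box_bound c f .. box_bound c f})"

lemma compactin_box: "compactin Cc_product (box c)"
  unfolding box_def by (simp add: compactin_PiE)

lemma levels_subset_box: "levels (ereal c) \<subseteq> box c"
proof
  fix z assume z: "z \<in> levels (ereal c)"
  have "\<bar>z f\<bar> \<le> box_bound c f" if "f \<in> Cc" for f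
  proof -
    have "(1, \<lambda>_. f) \<in> test_tuples" using that by (simp add: test_tuples_def)
    then have "J 1 (\<lambda>_. f) (coords 1 (\<lambda>_. f) z) \<le> ereal c" using z by (auto simp: levels_def)
    then show ?thesis using box_bound(2)[OF that, of "coords 1 (\<lambda>_. f) z"] by (simp add: coords_def)
  qed
  then show "z \<in> box c"
    using z by (auto simp: box_def levels_def PiE_iff abs_le_iff minus_le_iff)
qed

lemma rate_function_I: "rate_function vague_topology I"
  unfolding rate_function_def
proof (intro conjI ballI allI)
  fix \<mu> :: "'a measure"
  \<comment> \<open>A supremum over no tuples would be \<open>- \<infinity>\<close>; the zero test
    function supplies one tuple with a nonnegative value.\<close>
  have "(1, \<lambda>_ _. 0) \<in> (test_tuples :: (nat \<times> (nat \<Rightarrow> 'a \<Rightarrow> real)) set)"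
    by (simp add: test_tuples_def Cc_zero)
  from J_nonneg[OF this, of "fdvec 1 (\<lambda>_ _. 0) \<mu>"] J_le_I[OF this, of \<mu>]
  show "0 \<le> I \<mu>" by (auto simp: fdvec_def intro: order_trans)
next
  fix c
  have "{\<mu> \<in> topspace vague_topology. I \<mu> \<le> c} = {\<mu> \<in> topspace vague_topology. Cc_eval \<mu> \<in> levels c}"
    using I_le_iff by (auto simp: topspace_vague)
  then show "closedin vague_topology {\<mu> \<in> topspace vague_topology. I \<mu> \<le> c}"
    using closedin_continuous_map_preimage[OF continuous_map_Cc_eval closedin_levels] by simp
qed

lemma good_rate_function_I: "good_rate_function vague_topology I"
  unfolding good_rate_function_def
proof (intro conjI allI rate_function_I)
  fix c :: real
  have "Cc_eval ` {\<mu> \<in> radon_measures. I \<mu> \<le> ereal c} = Cc_eval ` radon_measures \<inter> levels (ereal c)"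
    using I_le_iff by auto
  moreover have "compactin Cc_product (Cc_eval ` radon_measures \<inter> levels (ereal c))"
    using levels_subset_box
    by (intro closed_compactin[OF compactin_box[of c]] closedin_Int closedin_levels
        closedin_Cc_eval_radon[OF lc]) auto
  ultimately show "compactin vague_topology {\<mu> \<in> topspace vague_topology. I \<mu> \<le> ereal c}"
    unfolding topspace_vague by (intro compactin_vagueI) auto
qed

section \<open>Lower and upper large deviation bounds\<close>

lemma ldp_lower_I:
  assumes G: "openin vague_topology G"
  shows "- (INF \<mu>\<in>G. I \<mu>) \<le> liminf (\<lambda>n. ereal (1 / a n) * eln (pr M \<xi> n G))"
proof -
  have "- I \<mu> \<le> liminf (\<lambda>n. ereal (1 / a n) * eln (pr M \<xi> n G))" if \<mu>: "\<mu> \<in> G" for \<mu>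
  proof -
    obtain W where W: "openin Cc_product W" "G = {\<mu> \<in> radon_measures. Cc_eval \<mu> \<in> W}"
      using G unfolding openin_vague_iff by blast
    then have "Cc_eval \<mu> \<in> W" using \<mu> by blast
    from Cc_product_neighbourhood[OF W(1) this] obtain m fs U where
      U: "(m, fs) \<in> test_tuples" "openin (Rm_topology m) U" "coords m fs (Cc_eval \<mu>) \<in> U"
        "\<And>z'. z' \<in> topspace Cc_product \<Longrightarrow> coords m fs z' \<in> U \<Longrightarrow> z' \<in> W"
      by metis
    have eq: "coords m fs (Cc_eval \<nu>) = fdvec m fs \<nu>" for \<nu>
      using U(1) by (intro coords_Cc_eval) (simp add: test_tuples_def)
    have "pr M (\<lambda>n \<omega>. fdvec m fs (\<xi> n \<omega>)) n U \<le> pr M \<xi> n G" for n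
      unfolding pr_def
    proof (rule emeasure_mono[OF _ sets_open[OF G]], clarify)
      fix \<omega> assume "\<omega> \<in> space (M n)" "fdvec m fs (\<xi> n \<omega>) \<in> U"
      moreover have "Cc_eval (\<xi> n \<omega>) \<in> topspace Cc_product" by (simp add: Cc_eval_def)
      ultimately show "\<xi> n \<omega> \<in> G"
        using U(4)[of "Cc_eval (\<xi> n \<omega>)"] eq xi_radon W(2) by auto
    qed
    then have le: "ereal (1 / a n) * eln (pr M (\<lambda>n \<omega>. fdvec m fs (\<xi> n \<omega>)) n U) \<le>
        ereal (1 / a n) * eln (pr M \<xi> n G)" for n
      by (intro scaled_eln_mono a_pos)
    have "- I \<mu> \<le> - J m fs (fdvec m fs \<mu>)" using J_le_I[OF U(1)] by simp
    also have "\<dots> \<le> liminf (\<lambda>n. ereal (1 / a n) * eln (pr M (\<lambda>n \<omega>. fdvec m fs (\<xi> n \<omega>)) n U))"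
      using U(3) eq by (intro ldp_openD[OF tuple_ldp(1)[OF U(1)] U(2)]) simp
    also have "\<dots> \<le> liminf (\<lambda>n. ereal (1 / a n) * eln (pr M \<xi> n G))"
      by (intro Liminf_mono always_eventually allI le)
    finally show ?thesis .
  qed
  then have "- liminf (\<lambda>n. ereal (1 / a n) * eln (pr M \<xi> n G)) \<le> (INF \<mu>\<in>G. I \<mu>)"
    by (intro INF_greatest) (simp add: ereal_uminus_le_reorder)
  then show ?thesis by (simp add: ereal_uminus_le_reorder)
qed

text \<open>The projective limit of the compact sets \<open>cl (fdvec F) \<inter> {J \<le> c}\<close> is nonempty if
  all of them are: this is the compactness of \<open>box c\<close>.\<close>
lemma finite_dimensional_separation:
  assumes F: "closedin vague_topology F" and c: "\<And>\<mu>. \<mu> \<in> F \<Longrightarrow> \<not> I \<mu> \<le> ereal c"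
  shows "\<exists>(m, fs)\<in>test_tuples.
    {x \<in> Rm_topology m closure_of (fdvec m fs ` F). J m fs x \<le> ereal c} = {}"
proof (rule ccontr)
  define K where "K m fs = {x \<in> Rm_topology m closure_of (fdvec m fs ` F). J m fs x \<le> ereal c}" for m fs
  define A where "A m fs = {z \<in> topspace Cc_product. coords m fs z \<in> K m fs}" for m fs
  assume "\<not> (\<exists>(m, fs)\<in>test_tuples.
    {x \<in> Rm_topology m closure_of (fdvec m fs ` F). J m fs x \<le> ereal c} = {})"
  then have ne: "K m fs \<noteq> {}" if "(m, fs) \<in> test_tuples" for m fs
    using that unfolding K_def by blast
  have Fr: "F \<subseteq> radon_measures" using closedin_subset[OF F] by (simp add: topspace_vague)
  have clA: "closedin Cc_product (A m fs)" if fs: "(m, fs) \<in> test_tuples" for m fs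
  proof -
    have "K m fs = Rm_topology m closure_of (fdvec m fs ` F) \<inter> {x \<in> topspace (Rm_topology m). J m fs x \<le> ereal c}"
      using closure_of_subset_topspace[of "Rm_topology m" "fdvec m fs ` F"] by (auto simp: K_def)
    then have "closedin (Rm_topology m) (K m fs)"
      using closedin_J_le[OF fs] by (simp add: closedin_Int)
    then show ?thesis
      unfolding A_def using fs
      by (intro closedin_continuous_map_preimage[OF continuous_map_coords]) (auto simp: test_tuples_def)
  qed
  have "box c \<inter> \<Inter>((\<lambda>(m, fs). A m fs) ` test_tuples) \<noteq> {}"
  proof (rule compactin_fip[THEN iffD1, OF compactin_box, THEN conjunct2, rule_format], intro conjI ballI allI impI)
    fix C assume "C \<in> (\<lambda>(m, fs). A m fs) ` test_tuples"
    then show "closedin Cc_product C" using clA by auto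
  next
    fix \<F> assume "finite \<F> \<and> \<F> \<subseteq> (\<lambda>(m, fs). A m fs) ` test_tuples"
    then obtain D where D: "D \<subseteq> test_tuples" "finite D" "\<F> = (\<lambda>(m, fs). A m fs) ` D"
      by (meson finite_subset_image)
    \<comment> \<open>Points of different sets \<open>K m fs\<close> need not fit together. Merging
      the functions of the finitely many tuples into one tuple \<open>gs\<close> gives a single
      point \<open>x\<close> whose coordinate selections serve all of them.\<close>
    define S where "S = (\<Union>(m, fs)\<in>D. fs ` {..<m})"
    have "finite S" "S \<subseteq> Cc" using D by (auto simp: S_def test_tuples_def)
    then obtain N gs where gs: "(N, gs) \<in> test_tuples" "S \<subseteq> gs ` {..<N}"
      using enumerate_test_functions by metis
    obtain x where x: "x \<in> K N gs" using ne[OF gs(1)] by blast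
    have xt: "x \<in> topspace (Rm_topology N)" and xJ: "J N gs x \<le> ereal c"
      and xcl: "x \<in> Rm_topology N closure_of (fdvec N gs ` F)"
      using x closure_of_subset_topspace[of "Rm_topology N" "fdvec N gs ` F"] by (auto simp: K_def)
    define idx where "idx f = inv_into {..<N} gs f" for f
    have idx: "idx f < N" "f = gs (idx f)" if "f \<in> S" for f
      using that gs(2) inv_into_into[of f gs "{..<N}"] f_inv_into_f[of f gs "{..<N}"]
      by (auto simp: idx_def)
    \<comment> \<open>The default \<open>0\<close> lies in every edge of the box, since
      \<open>box_bound\<close> is nonnegative.\<close>
    define z where "z = restrict (\<lambda>f. if f \<in> S then x (idx f) else 0) Cc"
    have "\<bar>z f\<bar> \<le> box_bound c f" if f: "f \<in> Cc" for f
    proof (cases "f \<in> S")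
      case True
      have 1: "(1, \<lambda>_. f) \<in> test_tuples" using f by (simp add: test_tuples_def)
      have "J 1 (\<lambda>_. f) (restrict (\<lambda>i. x (idx f)) {..<1}) \<le> J N gs x"
        using idx[OF True] by (intro J_reindex_le(2)[OF gs(1) 1 _ xt]) auto
      then have "J 1 (\<lambda>_. f) (restrict (\<lambda>i. x (idx f)) {..<1}) \<le> ereal c" using xJ by simp
      from box_bound(2)[OF f _ this] show ?thesis using True f by (simp add: z_def)
    next
      case False
      then show ?thesis using f box_bound(1)[OF f] by (simp add: z_def)
    qed
    moreover have "z \<in> extensional Cc" by (simp add: z_def)
    ultimately have "z \<in> box c" by (auto simp: box_def PiE_iff abs_le_iff minus_le_iff)
    moreover have "z \<in> A m fs" if mfs: "(m, fs) \<in> D" for m fs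
    proof -
      have fs: "(m, fs) \<in> test_tuples" using mfs D by blast
      have fsS: "fs i \<in> S" if "i < m" for i using that mfs by (force simp: S_def)
      have fsC: "fs i \<in> Cc" if "i < m" for i using that fs by (auto simp: test_tuples_def)
      let ?T = "\<lambda>x. restrict (\<lambda>i. x (idx (fs i))) {..<m}"
      have \<sigma>: "idx (fs i) < N \<and> fs i = gs (idx (fs i))" if "i < m" for i
        using idx fsS that by blast
      have zT: "coords m fs z = ?T x"
        using fsS fsC by (auto simp: coords_def z_def)
      \<comment> \<open>Coordinate selection is continuous, so it maps closures into closures, and
        it turns \<open>fdvec N gs\<close> into \<open>fdvec m fs\<close>.\<close>
      have "?T ` (Rm_topology N closure_of (fdvec N gs ` F)) \<subseteq>
          Rm_topology m closure_of (?T ` (fdvec N gs ` F))"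
        by (rule continuous_map_image_closure_subset[OF J_reindex_le(1)[OF gs(1) fs \<sigma> xt]])
      moreover have "?T ` (fdvec N gs ` F) = fdvec m fs ` F"
        unfolding image_image using \<sigma> by (intro image_cong refl) (auto simp: fdvec_def)
      ultimately have "?T x \<in> Rm_topology m closure_of (fdvec m fs ` F)" using xcl by auto
      moreover have "J m fs (?T x) \<le> ereal c"
        using J_reindex_le(2)[OF gs(1) fs \<sigma> xt] xJ by (rule order_trans)
      moreover have "z \<in> topspace Cc_product" by (simp add: z_def)
      ultimately show ?thesis by (simp add: A_def K_def zT)
    qed
    ultimately show "box c \<inter> \<Inter>\<F> \<noteq> {}" using D(3) by auto
  qed
  then obtain z where z: "\<And>m fs. (m, fs) \<in> test_tuples \<Longrightarrow> z \<in> A m fs" by blast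
  have zt: "z \<in> topspace Cc_product"
    using z[of 1 "\<lambda>_ _. 0"] by (simp add: A_def test_tuples_def Cc_zero)
  \<comment> \<open>Each neighbourhood of \<open>z\<close> contains one described by a single tuple,
    for which \<open>z\<close> projects into the closure of the image of \<open>F\<close>. This
    gives a limit point in the product; closedness of the image of the measures then places it in
    \<open>F\<close>.\<close>
  have zcl: "z \<in> Cc_product closure_of (Cc_eval ` F)"
    unfolding in_closure_of
  proof (intro conjI zt allI impI)
    fix W assume W: "z \<in> W \<and> openin Cc_product W"
    then obtain m fs U where
      U: "(m, fs) \<in> test_tuples" "openin (Rm_topology m) U" "coords m fs z \<in> U"
        "\<And>z'. z' \<in> topspace Cc_product \<Longrightarrow> coords m fs z' \<in> U \<Longrightarrow> z' \<in> W"
      using Cc_product_neighbourhood by metis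
    have "coords m fs z \<in> Rm_topology m closure_of (fdvec m fs ` F)"
      using z[OF U(1)] by (simp add: A_def K_def)
    then obtain \<mu> where \<mu>: "\<mu> \<in> F" "fdvec m fs \<mu> \<in> U"
      using U(2,3) unfolding in_closure_of by blast
    have "coords m fs (Cc_eval \<mu>) \<in> U"
      using \<mu>(2) U(1) by (subst coords_Cc_eval) (simp_all add: test_tuples_def)
    then have "Cc_eval \<mu> \<in> W" using U(4)[of "Cc_eval \<mu>"] by (simp add: Cc_eval_def)
    then show "\<exists>y. y \<in> Cc_eval ` F \<and> y \<in> W" using \<mu>(1) by blast
  qed
  obtain C where C: "closedin Cc_product C" "F = {\<mu> \<in> radon_measures. Cc_eval \<mu> \<in> C}"
    using closedin_vagueE[OF F] by metis
  have "Cc_eval ` F \<subseteq> C" "Cc_eval ` F \<subseteq> Cc_eval ` radon_measures" using C(2) by auto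
  then have "z \<in> C" "z \<in> Cc_eval ` radon_measures"
    using zcl closure_of_minimal[OF _ C(1)] closure_of_minimal[OF _ closedin_Cc_eval_radon[OF lc]] by blast+
  then obtain \<mu> where \<mu>: "\<mu> \<in> F" "z = Cc_eval \<mu>" using C(2) by blast
  have "z \<in> levels (ereal c)"
    using z zt by (auto simp: levels_def A_def K_def)
  then have "I \<mu> \<le> ereal c" using I_le_iff \<mu> Fr by auto
  then show False using c \<mu>(1) by blast
qed

text \<open>Arguing by contradiction provides a real level \<open>- r\<close> below the infimum,
  even an infinite one. Separation then traps \<open>F\<close> in the preimage of a closed
  finite-dimensional set on which the rate exceeds \<open>- r\<close>.\<close>

lemma ldp_upper_I:
  assumes F: "closedin vague_topology F"
  shows "limsup (\<lambda>n. ereal (1 / a n) * eln (pr M \<xi> n F)) \<le> - (INF \<mu>\<in>F. I \<mu>)" (is "?l \<le> _")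
proof (rule ccontr)
  assume "\<not> ?l \<le> - (INF \<mu>\<in>F. I \<mu>)"
  then have "- (INF \<mu>\<in>F. I \<mu>) < ?l" by simp
  then obtain r where r: "- (INF \<mu>\<in>F. I \<mu>) < ereal r" "ereal r < ?l"
    using ereal_dense2 by blast
  have "ereal (- r) < (INF \<mu>\<in>F. I \<mu>)"
    using r(1) by (metis ereal_uminus_less_reorder uminus_ereal.simps(1))
  then have "\<not> I \<mu> \<le> ereal (- r)" if "\<mu> \<in> F" for \<mu>
    using less_INF_D[OF _ that] by (simp add: not_le)
  then obtain m fs where fs: "(m, fs) \<in> test_tuples"
    "{x \<in> Rm_topology m closure_of (fdvec m fs ` F). J m fs x \<le> ereal (- r)} = {}"
    using finite_dimensional_separation[OF F, of "- r"] by blast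
  let ?C = "Rm_topology m closure_of (fdvec m fs ` F)"
  have cl: "closedin (Rm_topology m) ?C" by simp
  have sub: "fdvec m fs ` F \<subseteq> ?C"
    by (rule closure_of_subset) (auto simp: fdvec_def split: if_splits)
  have "pr M \<xi> n F \<le> pr M (\<lambda>n \<omega>. fdvec m fs (\<xi> n \<omega>)) n ?C" for n
    unfolding pr_def using sub by (intro emeasure_mono sets_fdvec_closed[OF fs(1) cl]) auto
  then have le: "ereal (1 / a n) * eln (pr M \<xi> n F) \<le>
      ereal (1 / a n) * eln (pr M (\<lambda>n \<omega>. fdvec m fs (\<xi> n \<omega>)) n ?C)" for n
    by (intro scaled_eln_mono a_pos)
  have "?l \<le> limsup (\<lambda>n. ereal (1 / a n) * eln (pr M (\<lambda>n \<omega>. fdvec m fs (\<xi> n \<omega>)) n ?C))"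
    by (intro Limsup_mono always_eventually allI le)
  also have "\<dots> \<le> - ereal (- r)"
    using fs(2) by (intro ldp_closedD[OF tuple_ldp(1)[OF fs(1)] cl]) (auto simp: not_le intro: less_imp_le)
  finally show False using r(2) by simp
qed

lemma ldp_I: "ldp vague_topology M \<xi> a I"
  unfolding ldp_def using rate_function_I ldp_upper_I ldp_lower_I by blast

end

section \<open>Laplace asymptotics and convex duality\<close>

text \<open>Sublevel sets above a finite infimum are nonempty, nested and compact, so they share a
  point. Used for zeros of rate functions and for the minimiser of the regularisation.\<close>

lemma good_rate_function_attains_min:
  assumes good: "good_rate_function X h" and x0: "x0 \<in> topspace X"
  obtains x where "x \<in> topspace X" "\<And>y. y \<in> topspace X \<Longrightarrow> h x \<le> h y"
proof -
  define i where "i = (INF y\<in>topspace X. h y)"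
  have lower: "i \<le> h y" if "y \<in> topspace X" for y
    unfolding i_def using that by (rule INF_lower)
  have "0 \<le> i"
    using good unfolding i_def good_rate_function_def rate_function_def by (intro INF_greatest) blast
  then consider "i = \<infinity>" | c where "i = ereal c" by (cases i) auto
  then show ?thesis
  proof cases
    case 1
    then show ?thesis using lower that[OF x0] by (metis ereal_infty_less_eq(1) ereal_less_eq(1))
  next
    case 2
    define S where "S r = {x \<in> topspace X. h x \<le> ereal r}" for r
    have clS: "closedin X (S r)" and cS: "compactin X (S r)" for r
      using good by (auto simp: S_def good_rate_function_def rate_function_def)
    have ne: "S r \<noteq> {}" if "c < r" for r
    proof -
      have "i < ereal r" using that 2 by simp
      then obtain y where "y \<in> topspace X" "h y < ereal r" unfolding i_def INF_less_iff by blast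
      then have "y \<in> S r" by (simp add: S_def)
      then show ?thesis by blast
    qed
    have "S (c + 1) \<inter> \<Inter>(S ` {c<..}) \<noteq> {}"
    proof (rule compactin_fip[THEN iffD1, OF cS, THEN conjunct2, rule_format], intro conjI ballI allI impI)
      fix C assume "C \<in> S ` {c<..}"
      then show "closedin X C" using clS by auto
    next
      fix \<F> assume "finite \<F> \<and> \<F> \<subseteq> S ` {c<..}"
      then obtain R where R: "R \<subseteq> {c<..}" "finite R" "\<F> = S ` R"
        by (meson finite_subset_image)
      define r where "r = Min (insert (c + 1) R)"
      have "c < r" using R by (auto simp: r_def)
      then obtain y where y: "y \<in> S r" using ne by blast
      have "y \<in> S r'" if "r' \<in> insert (c + 1) R" for r'
      proof -
        have "r \<le> r'" unfolding r_def using that R(2) by (intro Min_le) auto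
        then show ?thesis using y unfolding S_def by (auto intro: order_trans)
      qed
      then show "S (c + 1) \<inter> \<Inter>\<F> \<noteq> {}" using R(3) by blast
    qed
    then obtain x where x: "\<And>r. c < r \<Longrightarrow> x \<in> S r" by blast
    have xt: "x \<in> topspace X" using x[of "c + 1"] by (simp add: S_def)
    have "h x \<le> ereal c + ereal e" if "e > 0" for e
      using x[of "c + e"] that by (simp add: S_def)
    then have "h x \<le> i" unfolding 2 by (rule ereal_le_epsilon2)
    then show ?thesis using that[OF xt] lower order_trans by blast
  qed
qed

text \<open>The whole space is closed and has probability 1, so the upper bound forces the infimum
  of \<open>J\<close> down to 0; goodness ensures that it is attained.\<close>

lemma ldp_zero:
  assumes ldp: "ldp X M Z a J" and good: "good_rate_function X J"
    and prob: "\<And>n. prob_space (M n)" and Z: "\<And>n \<omega>. \<omega> \<in> space (M n) \<Longrightarrow> Z n \<omega> \<in> topspace X"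
  obtains x where "x \<in> topspace X" "J x = 0"
proof -
  obtain \<omega> where "\<omega> \<in> space (M 0)" using prob_space.not_empty[OF prob] by blast
  then obtain x where x: "x \<in> topspace X" "\<And>y. y \<in> topspace X \<Longrightarrow> J x \<le> J y"
    using good_rate_function_attains_min[OF good Z] by metis
  have "{\<omega> \<in> space (M n). Z n \<omega> \<in> topspace X} = space (M n)" for n using Z by auto
  then have "pr M Z n (topspace X) = 1" for n
    unfolding pr_def using prob_space.emeasure_space_1[OF prob] by simp
  then have "limsup (\<lambda>n. ereal (1 / a n) * eln (pr M Z n (topspace X))) = 0"
    by (simp add: eln_def Limsup_const)
  moreover have "limsup (\<lambda>n. ereal (1 / a n) * eln (pr M Z n (topspace X))) \<le> - J x"
    by (rule ldp_closedD[OF ldp closedin_topspace x(2)])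
  ultimately have "J x \<le> 0" by simp
  moreover have "0 \<le> J x" using ldp x(1) by (simp add: ldp_def rate_function_def)
  ultimately show ?thesis using that[OF x(1)] by simp
qed

text \<open>Varadhan's lemma, by slicing along the values of \<open>F\<close> instead of covering a compact set.\<close>
lemma ldp_laplace_upper:
  assumes ldp: "ldp X M Z a J" and a: "\<And>n. a n > 0" "filterlim a at_top sequentially"
    and prob: "\<And>n. prob_space (M n)" and F: "continuous_map X euclideanreal F"
    and Y: "\<And>n. Y n \<in> borel_measurable (M n)"
    and YF: "\<And>n \<omega>. \<omega> \<in> space (M n) \<Longrightarrow> Y n \<omega> = F (Z n \<omega>)"
    and Z: "\<And>n \<omega>. \<omega> \<in> space (M n) \<Longrightarrow> Z n \<omega> \<in> topspace X"
    and moment: "\<And>n. (\<integral>\<^sup>+ \<omega>. ennreal (exp (a n * (2 * Y n \<omega>))) \<partial>M n) \<le> ennreal (exp (a n * B))"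
    and s: "\<And>x. x \<in> topspace X \<Longrightarrow> ereal (F x - s) \<le> J x"
  shows "limsup (\<lambda>n. ereal (1 / a n) * eln (\<integral>\<^sup>+ \<omega>. ennreal (exp (a n * Y n \<omega>)) \<partial>M n)) \<le> ereal s"
proof (rule ereal_le_epsilon2)
  fix \<epsilon> :: real assume "\<epsilon> > 0"
  \<comment> \<open>One \<open>\<delta>\<close> pays for the width of a slice, one for the slack in
    the LDP bound, and one for the number \<open>N + 2\<close> of terms: \<open>N\<close> slices and
    two tails.\<close>
  define \<delta> where "\<delta> = \<epsilon> / 3"
  have \<delta>: "\<delta> > 0" "\<epsilon> = 3 * \<delta>" using \<open>\<epsilon> > 0\<close> by (auto simp: \<delta>_def)
  \<comment> \<open>Both tails are then at most \<open>exp (a n * s)\<close>: below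
    \<open>- K\<close> because \<open>- K \<le> s\<close>, and above \<open>K\<close> because
    doubling the exponent gains a factor \<open>exp (- a n * K)\<close> and
    \<open>B - K \<le> s\<close>.\<close>
  define K where "K = \<bar>s\<bar> + \<bar>B\<bar>"
  obtain N :: nat where N: "2 * K \<le> real N * \<delta>"
    using reals_Archimedean3[OF \<delta>(1)] less_imp_le by metis
  define t where "t j = - K + real j * \<delta>" for j
  define C where "C j = {x \<in> topspace X. F x \<in> {t j..t (Suc j)}}" for j
  have clC: "closedin X (C j)" for j
    unfolding C_def by (rule closedin_continuous_map_preimage[OF F]) simp
  have "eventually (\<lambda>n. pr M Z n (C j) \<le> ennreal (exp (a n * (s - t j + \<delta>)))) sequentially" for j
  proof -
    have "limsup (\<lambda>n. ereal (1 / a n) * eln (pr M Z n (C j))) \<le> - ereal (t j - s)"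
    proof (rule ldp_closedD[OF ldp clC])
      fix x assume "x \<in> C j"
      then have "ereal (t j - s) \<le> ereal (F x - s)" "ereal (F x - s) \<le> J x"
        using s by (auto simp: C_def)
      then show "ereal (t j - s) \<le> J x" by (rule order_trans)
    qed
    also have "\<dots> < ereal (s - t j + \<delta>)" using \<delta>(1) by simp
    finally have "eventually (\<lambda>n. ereal (1 / a n) * eln (pr M Z n (C j)) < ereal (s - t j + \<delta>)) sequentially"
      by (rule Limsup_lessD)
    then show ?thesis
      by (rule eventually_mono) (simp only: scaled_eln_le_iff[OF a(1), symmetric] less_imp_le)
  qed
  then have "eventually (\<lambda>n. \<forall>j\<in>{..<N}. pr M Z n (C j) \<le> ennreal (exp (a n * (s - t j + \<delta>)))) sequentially"
    by (intro eventually_ball_finite) auto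
  \<comment> \<open>A fixed number of terms is negligible on the exponential scale:
    \<open>N + 2 \<le> a n * \<delta> \<le> exp (a n * \<delta>)\<close> for large
    \<open>n\<close>.\<close>
  moreover have "eventually (\<lambda>n. a n \<ge> real (N + 2) / \<delta>) sequentially"
    using a(2) unfolding filterlim_at_top by blast
  ultimately have "eventually (\<lambda>n. (\<integral>\<^sup>+ \<omega>. ennreal (exp (a n * Y n \<omega>)) \<partial>M n) \<le> ennreal (exp (a n * (s + \<epsilon>)))) sequentially"
  proof eventually_elim
    case (elim n)
    have an: "a n > 0" by (rule a(1))
    define e where "e = exp (a n * (s + 2 * \<delta>))"
    have e0: "0 \<le> e" by (simp add: e_def)
    define E where "E j = {\<omega> \<in> space (M n). Z n \<omega> \<in> C j}" for j
    have E_eq: "E j = {\<omega> \<in> space (M n). Y n \<omega> \<in> {t j..t (Suc j)}}" for j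
      unfolding E_def C_def using YF Z by auto
    have Em [measurable]: "E j \<in> sets (M n)" for j
      unfolding E_eq using Y[of n] by measurable
    have [measurable]: "Y n \<in> borel_measurable (M n)" by (rule Y)
    have pt: "ennreal (exp (a n * Y n \<omega>)) \<le> ennreal (exp (- a n * K))
        + ennreal (exp (- a n * K)) * ennreal (exp (a n * (2 * Y n \<omega>)))
        + (\<Sum>j<N. ennreal (exp (a n * t (Suc j))) * indicator (E j) \<omega>)"
      if \<omega>: "\<omega> \<in> space (M n)" for \<omega>
    proof -
      have add3: "p \<le> p + q + r" "q \<le> p + q + r" "r \<le> p + q + r" for p q r :: ennreal
        by (simp_all add: add_increasing add_increasing2)
      consider "Y n \<omega> \<le> - K" | "Y n \<omega> \<ge> K" | "- K < Y n \<omega>" "Y n \<omega> < K" by linarith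
      then show ?thesis
      proof cases
        case 1
        then have "a n * Y n \<omega> \<le> a n * (- K)" using an by (intro mult_left_mono) auto
        then have "ennreal (exp (a n * Y n \<omega>)) \<le> ennreal (exp (- a n * K))" by (intro ennreal_leI) simp
        then show ?thesis by (rule order_trans[OF _ add3(1)])
      next
        case 2
        then have "a n * K \<le> a n * Y n \<omega>" using an by (intro mult_left_mono) auto
        then have "exp (a n * Y n \<omega>) \<le> exp (- a n * K) * exp (a n * (2 * Y n \<omega>))"
          by (simp add: exp_add[symmetric])
        then have "ennreal (exp (a n * Y n \<omega>)) \<le> ennreal (exp (- a n * K)) * ennreal (exp (a n * (2 * Y n \<omega>)))"
          by (simp add: ennreal_mult[symmetric] ennreal_leI)
        then show ?thesis by (rule order_trans[OF _ add3(2)])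
      next
        case 3
        define j where "j = nat \<lfloor>(Y n \<omega> + K) / \<delta>\<rfloor>"
        have q: "0 \<le> (Y n \<omega> + K) / \<delta>" using 3 \<delta>(1) by simp
        have j1: "real j \<le> (Y n \<omega> + K) / \<delta>" "(Y n \<omega> + K) / \<delta> < real j + 1"
          using q by (auto simp: j_def)
        then have j2: "real j * \<delta> \<le> Y n \<omega> + K" "Y n \<omega> + K < (real j + 1) * \<delta>"
          using \<delta>(1) by (auto simp: field_simps)
        have "real j * \<delta> < real N * \<delta>" using j2(1) 3 N by linarith
        then have jN: "j < N" using \<delta>(1) by simp
        have jE: "\<omega> \<in> E j" using j2 \<omega> unfolding E_eq t_def by (auto simp: algebra_simps)
        have "a n * Y n \<omega> \<le> a n * t (Suc j)"
          using jE an unfolding E_eq by (intro mult_left_mono) auto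
        then have "ennreal (exp (a n * Y n \<omega>)) \<le> ennreal (exp (a n * t (Suc j))) * indicator (E j) \<omega>"
          using jE by (simp add: ennreal_leI)
        also have "\<dots> \<le> (\<Sum>j<N. ennreal (exp (a n * t (Suc j))) * indicator (E j) \<omega>)"
          using jN by (intro member_le_sum) auto
        finally show ?thesis by (rule order_trans[OF _ add3(3)])
      qed
    qed
    have "(\<integral>\<^sup>+ \<omega>. ennreal (exp (a n * Y n \<omega>)) \<partial>M n) \<le> (\<integral>\<^sup>+ \<omega>. ennreal (exp (- a n * K))
        + ennreal (exp (- a n * K)) * ennreal (exp (a n * (2 * Y n \<omega>)))
        + (\<Sum>j<N. ennreal (exp (a n * t (Suc j))) * indicator (E j) \<omega>) \<partial>M n)"
      by (intro nn_integral_mono pt)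
    also have "\<dots> = (\<integral>\<^sup>+ \<omega>. ennreal (exp (- a n * K))
          + ennreal (exp (- a n * K)) * ennreal (exp (a n * (2 * Y n \<omega>))) \<partial>M n)
        + (\<integral>\<^sup>+ \<omega>. (\<Sum>j<N. ennreal (exp (a n * t (Suc j))) * indicator (E j) \<omega>) \<partial>M n)"
      by (rule nn_integral_add) measurable
    also have "(\<integral>\<^sup>+ \<omega>. (\<Sum>j<N. ennreal (exp (a n * t (Suc j))) * indicator (E j) \<omega>) \<partial>M n)
        = (\<Sum>j<N. \<integral>\<^sup>+ \<omega>. ennreal (exp (a n * t (Suc j))) * indicator (E j) \<omega> \<partial>M n)"
      by (rule nn_integral_sum) measurable
    also have "\<dots> = (\<Sum>j<N. ennreal (exp (a n * t (Suc j))) * emeasure (M n) (E j))"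
      by (intro sum.cong refl nn_integral_cmult_indicator Em)
    also have "(\<integral>\<^sup>+ \<omega>. ennreal (exp (- a n * K))
          + ennreal (exp (- a n * K)) * ennreal (exp (a n * (2 * Y n \<omega>))) \<partial>M n)
        = (\<integral>\<^sup>+ \<omega>. ennreal (exp (- a n * K)) \<partial>M n)
          + (\<integral>\<^sup>+ \<omega>. ennreal (exp (- a n * K)) * ennreal (exp (a n * (2 * Y n \<omega>))) \<partial>M n)"
      by (rule nn_integral_add) measurable
    also have "(\<integral>\<^sup>+ \<omega>. ennreal (exp (- a n * K)) * ennreal (exp (a n * (2 * Y n \<omega>))) \<partial>M n)
        = ennreal (exp (- a n * K)) * (\<integral>\<^sup>+ \<omega>. ennreal (exp (a n * (2 * Y n \<omega>))) \<partial>M n)"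
      by (rule nn_integral_cmult) measurable
    also have "(\<integral>\<^sup>+ \<omega>. ennreal (exp (- a n * K)) \<partial>M n) = ennreal (exp (- a n * K))"
      by (simp add: prob_space.emeasure_space_1[OF prob])
    finally have "(\<integral>\<^sup>+ \<omega>. ennreal (exp (a n * Y n \<omega>)) \<partial>M n) \<le> ennreal (exp (- a n * K))
        + ennreal (exp (- a n * K)) * (\<integral>\<^sup>+ \<omega>. ennreal (exp (a n * (2 * Y n \<omega>))) \<partial>M n)
        + (\<Sum>j<N. ennreal (exp (a n * t (Suc j))) * emeasure (M n) (E j))" .
    also have "\<dots> \<le> ennreal e + ennreal e + (\<Sum>j<N. ennreal e)"
    proof (intro add_mono sum_mono)
      have "a n * (- K) \<le> a n * (s + 2 * \<delta>)" "a n * (B - K) \<le> a n * (s + 2 * \<delta>)"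
        using an \<delta>(1) unfolding K_def by (auto intro!: mult_left_mono)
      then have *: "exp (- a n * K) \<le> e" "exp (- a n * K) * exp (a n * B) \<le> e"
        unfolding e_def by (auto simp: exp_add[symmetric] algebra_simps)
      from *(1) show "ennreal (exp (- a n * K)) \<le> ennreal e" by (rule ennreal_leI)
      have "ennreal (exp (- a n * K)) * (\<integral>\<^sup>+ \<omega>. ennreal (exp (a n * (2 * Y n \<omega>))) \<partial>M n)
          \<le> ennreal (exp (- a n * K)) * ennreal (exp (a n * B))"
        by (intro mult_left_mono moment) simp
      also have "\<dots> \<le> ennreal e" using *(2) by (simp add: ennreal_mult[symmetric] ennreal_leI)
      finally show "ennreal (exp (- a n * K)) * (\<integral>\<^sup>+ \<omega>. ennreal (exp (a n * (2 * Y n \<omega>))) \<partial>M n) \<le> ennreal e" .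
      fix j assume "j \<in> {..<N}"
      then have "emeasure (M n) (E j) \<le> ennreal (exp (a n * (s - t j + \<delta>)))"
        using elim(1) unfolding pr_def E_def by blast
      then have "ennreal (exp (a n * t (Suc j))) * emeasure (M n) (E j)
          \<le> ennreal (exp (a n * t (Suc j))) * ennreal (exp (a n * (s - t j + \<delta>)))"
        by (intro mult_left_mono) auto
      also have "\<dots> = ennreal e"
        by (simp add: ennreal_mult[symmetric] e_def exp_add[symmetric] t_def algebra_simps)
      finally show "ennreal (exp (a n * t (Suc j))) * emeasure (M n) (E j) \<le> ennreal e" .
    qed
    also have "\<dots> = ennreal (e + e + (\<Sum>j<N. e))"
      using e0 by (simp only: sum_ennreal ennreal_plus add_nonneg_nonneg sum_nonneg)
    also have "e + e + (\<Sum>j<N. e) = real (N + 2) * e" by (simp add: algebra_simps)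
    also have "\<dots> \<le> ennreal (exp (a n * (s + \<epsilon>)))"
    proof (rule ennreal_leI)
      have "real (N + 2) \<le> a n * \<delta>" using elim(2) \<delta>(1) by (simp add: pos_divide_le_eq)
      also have "\<dots> \<le> exp (a n * \<delta>)" using exp_ge_add_one_self[of "a n * \<delta>"] by linarith
      finally have "real (N + 2) * e \<le> exp (a n * \<delta>) * e"
        by (intro mult_right_mono) (auto simp: e_def)
      also have "\<dots> = exp (a n * (s + \<epsilon>))"
        by (simp add: e_def \<delta>(2) exp_add[symmetric] algebra_simps)
      finally show "real (N + 2) * e \<le> exp (a n * (s + \<epsilon>))" .
    qed
    finally show ?case .
  qed
  then have "limsup (\<lambda>n. ereal (1 / a n) * eln (\<integral>\<^sup>+ \<omega>. ennreal (exp (a n * Y n \<omega>)) \<partial>M n)) \<le> ereal (s + \<epsilon>)"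
    by (intro Limsup_bounded) (simp only: scaled_eln_le_iff[OF a(1)])
  then show "limsup (\<lambda>n. ereal (1 / a n) * eln (\<integral>\<^sup>+ \<omega>. ennreal (exp (a n * Y n \<omega>)) \<partial>M n)) \<le> ereal s + ereal \<epsilon>"
    by simp
qed

text \<open>On the open set \<open>F > F x - \<delta>\<close> the integrand is at least
  \<open>exp (a n * (F x - \<delta>))\<close>, and the LDP bounds the probability of that set from
  below. Arguing by contradiction makes \<open>J x\<close> finite.\<close>

lemma ldp_laplace_lower:
  assumes ldp: "ldp X M Z a J" and a: "\<And>n. a n > 0" and F: "continuous_map X euclideanreal F"
    and Y: "\<And>n. Y n \<in> borel_measurable (M n)"
    and YF: "\<And>n \<omega>. \<omega> \<in> space (M n) \<Longrightarrow> Y n \<omega> = F (Z n \<omega>)"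
    and Z: "\<And>n \<omega>. \<omega> \<in> space (M n) \<Longrightarrow> Z n \<omega> \<in> topspace X"
    and x: "x \<in> topspace X"
  shows "ereal (F x) - J x \<le> liminf (\<lambda>n. ereal (1 / a n) * eln (\<integral>\<^sup>+ \<omega>. ennreal (exp (a n * Y n \<omega>)) \<partial>M n))"
    (is "_ \<le> ?L")
proof (rule ccontr)
  assume "\<not> ereal (F x) - J x \<le> ?L"
  then obtain r where r: "?L < ereal r" "ereal r < ereal (F x) - J x"
    using ereal_dense2[of ?L "ereal (F x) - J x"] by (auto simp: not_le)
  have "0 \<le> J x" using ldp x by (simp add: ldp_def rate_function_def)
  then obtain j where j: "J x = ereal j" using r(2) by (cases "J x") auto
  \<comment> \<open>Half of the gap goes to the drop of \<open>F\<close> on \<open>G\<close>, half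
    to the slack in the lower bound.\<close>
  define \<delta> where "\<delta> = (F x - j - r) / 2"
  have \<delta>: "\<delta> > 0" "r = F x - j - 2 * \<delta>" using r(2) j by (simp_all add: \<delta>_def field_simps)
  define G where "G = {y \<in> topspace X. F y \<in> {F x - \<delta><..}}"
  have G: "openin X G" "x \<in> G"
    using openin_continuous_map_preimage[OF F, of "{F x - \<delta><..}"] x \<delta>(1) by (auto simp: G_def)
  have "ereal (- j - \<delta>) < - J x" using \<delta>(1) j by simp
  also have "\<dots> \<le> liminf (\<lambda>n. ereal (1 / a n) * eln (pr M Z n G))" by (rule ldp_openD[OF ldp G])
  finally have "eventually (\<lambda>n. ereal (- j - \<delta>) < ereal (1 / a n) * eln (pr M Z n G)) sequentially"
    by (rule less_LiminfD)
  then have "eventually (\<lambda>n. ereal r \<le> ereal (1 / a n) * eln (\<integral>\<^sup>+ \<omega>. ennreal (exp (a n * Y n \<omega>)) \<partial>M n)) sequentially"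
  proof eventually_elim
    case (elim n)
    define E where "E = {\<omega> \<in> space (M n). Z n \<omega> \<in> G}"
    have E_eq: "E = {\<omega> \<in> space (M n). Y n \<omega> \<in> {F x - \<delta><..}}"
      unfolding E_def G_def using YF Z by auto
    have Em: "E \<in> sets (M n)" unfolding E_eq using Y[of n] by measurable
    have "ennreal (exp (a n * r)) = ennreal (exp (a n * (F x - \<delta>))) * ennreal (exp (a n * (- j - \<delta>)))"
      by (simp add: ennreal_mult[symmetric] exp_add[symmetric] \<delta>(2) algebra_simps)
    also have "\<dots> \<le> ennreal (exp (a n * (F x - \<delta>))) * emeasure (M n) E"
      using elim unfolding scaled_eln_less_iff[OF a] pr_def E_def by (intro mult_left_mono) auto
    also have "\<dots> = (\<integral>\<^sup>+ \<omega>. ennreal (exp (a n * (F x - \<delta>))) * indicator E \<omega> \<partial>M n)"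
      using Em by (simp add: nn_integral_cmult_indicator)
    also have "\<dots> \<le> (\<integral>\<^sup>+ \<omega>. ennreal (exp (a n * Y n \<omega>)) \<partial>M n)"
    proof (rule nn_integral_mono)
      fix \<omega>
      have "a n * (F x - \<delta>) \<le> a n * Y n \<omega>" if "\<omega> \<in> E"
        using that a[of n] unfolding E_eq by (intro mult_left_mono) auto
      then show "ennreal (exp (a n * (F x - \<delta>))) * indicator E \<omega> \<le> ennreal (exp (a n * Y n \<omega>))"
        by (auto simp: indicator_def intro!: ennreal_leI)
    qed
    finally show ?case by (simp only: scaled_eln_ge_iff[OF a])
  qed
  then have "ereal r \<le> ?L" by (rule Liminf_bounded)
  then show False using r(1) by simp
qed

text \<open>Stands for the limit \<open>t \<rightarrow> 0\<close> in a first-order optimality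
  condition.\<close>

lemma nonneg_of_small_perturbation:
  fixes A B :: real
  assumes "\<And>t. 0 < t \<Longrightarrow> t \<le> 1 \<Longrightarrow> 0 \<le> A + t * B"
  shows "0 \<le> A"
proof (rule ccontr)
  assume A: "\<not> 0 \<le> A"
  \<comment> \<open>Chosen so that \<open>t * B \<le> - A / 2\<close>; the \<open>+ 1\<close> covers
    \<open>B = 0\<close>.\<close>
  define t where "t = min 1 (- A / (2 * (\<bar>B\<bar> + 1)))"
  have t: "0 < t" "t \<le> 1" using A by (auto simp: t_def divide_neg_pos)
  have "t * B \<le> t * (\<bar>B\<bar> + 1)" using t by (intro mult_left_mono) auto
  also have "\<dots> \<le> (- A / (2 * (\<bar>B\<bar> + 1))) * (\<bar>B\<bar> + 1)"
    by (intro mult_right_mono) (auto simp: t_def)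
  also have "\<dots> = - A / 2" by (simp add: field_simps)
  finally show False using assms[OF t] A by linarith
qed

lemma continuous_map_Rm_sum:
  assumes "\<And>i. i < m \<Longrightarrow> continuous_on UNIV (g i)"
  shows "continuous_map (Rm_topology m) euclideanreal (\<lambda>x. \<Sum>i<m. g i (x i) :: real)"
proof (rule continuous_map_sum)
  fix i assume i: "i \<in> {..<m}"
  have "continuous_map (Rm_topology m) euclideanreal (\<lambda>x. x i)"
    using i continuous_map_product_projection[of i "{..<m}" "\<lambda>_. euclideanreal"] by simp
  moreover have "continuous_map euclideanreal euclideanreal (g i)" using assms i by simp
  ultimately have "continuous_map (Rm_topology m) euclideanreal (g i \<circ> (\<lambda>x. x i))"
    by (rule continuous_map_compose)
  then show "continuous_map (Rm_topology m) euclideanreal (\<lambda>x. g i (x i))" by (simp add: o_def)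
qed simp

text \<open>Links the product topology to the squared Euclidean distance, the penalty of the
  Moreau--Yosida regularisation.\<close>

lemma Rm_ball_subset:
  assumes W: "openin (Rm_topology m) W" "x0 \<in> W"
  obtains r where "r > 0" "\<And>x. x \<in> topspace (Rm_topology m) \<Longrightarrow> (\<Sum>i<m. (x i - x0 i)\<^sup>2) < r \<Longrightarrow> x \<in> W"
proof -
  obtain X where X: "x0 \<in> (\<Pi>\<^sub>E i\<in>{..<m}. X i)" "\<And>i. open (X i)" "(\<Pi>\<^sub>E i\<in>{..<m}. X i) \<subseteq> W"
    using product_topology_open_contains_basis[OF W] by auto
  have "\<exists>e>0. i < m \<longrightarrow> ball (x0 i) e \<subseteq> X i" for i
  proof (cases "i < m")
    case True
    then have "x0 i \<in> X i" using X(1) by auto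
    then show ?thesis using X(2)[of i] open_contains_ball by blast
  qed (auto intro: exI[of _ 1])
  then obtain e where e: "\<And>i. e i > 0" "\<And>i. i < m \<Longrightarrow> ball (x0 i) (e i) \<subseteq> X i" by metis
  \<comment> \<open>The inserted \<open>1\<close> keeps \<open>Min\<close> meaningful for
    \<open>m = 0\<close>.\<close>
  define r where "r = Min (insert 1 ((\<lambda>i. (e i)\<^sup>2) ` {..<m}))"
  show ?thesis
  proof
    show "r > 0" unfolding r_def by (subst Min_gr_iff) (auto, metis e(1) less_irrefl)
    fix x assume x: "x \<in> topspace (Rm_topology m)" "(\<Sum>i<m. (x i - x0 i)\<^sup>2) < r"
    have "x i \<in> X i" if i: "i < m" for i
    proof -
      have "(x i - x0 i)\<^sup>2 \<le> (\<Sum>i<m. (x i - x0 i)\<^sup>2)"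
        using i by (intro member_le_sum[of i "{..<m}" "\<lambda>i. (x i - x0 i)\<^sup>2"]) auto
      also have "\<dots> < r" by (rule x(2))
      also have "r \<le> (e i)\<^sup>2" unfolding r_def using i by (intro Min_le) auto
      finally have "\<bar>x i - x0 i\<bar>\<^sup>2 < (e i)\<^sup>2" by simp
      then have "\<bar>x i - x0 i\<bar> < e i" by (rule power2_less_imp_less) (simp add: less_imp_le e(1))
      then show ?thesis using e(2)[OF i] by (auto simp: dist_real_def abs_minus_commute subset_eq)
    qed
    then have "x \<in> (\<Pi>\<^sub>E i\<in>{..<m}. X i)" using x(1) by (auto simp: PiE_iff)
    then show "x \<in> W" using X(3) by blast
  qed
qed

text \<open>The sum exceeds \<open>c\<close> exactly when \<open>J > r\<close> and
  \<open>q > s\<close> for some reals with \<open>c \<le> r + s\<close>, so the complement of a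
  sublevel set is a union of open sets. Compactness is inherited from \<open>J\<close> because
  \<open>q\<close> is nonnegative.\<close>

lemma good_rate_function_add_continuous:
  assumes good: "good_rate_function X J" and q: "continuous_map X euclideanreal q"
    and q0: "\<And>x. x \<in> topspace X \<Longrightarrow> 0 \<le> q x"
  shows "good_rate_function X (\<lambda>x. J x + ereal (q x))"
proof -
  have rate: "rate_function X J" using good by (simp add: good_rate_function_def)
  have J0: "0 \<le> J x" if "x \<in> topspace X" for x using rate that by (simp add: rate_function_def)
  have cl: "closedin X {x \<in> topspace X. J x + ereal (q x) \<le> c}" for c
  proof -
    have "openin X ((topspace X - {x \<in> topspace X. J x \<le> ereal r}) \<inter> {x \<in> topspace X. q x \<in> {s<..}})" for r s
      using rate unfolding rate_function_def
      by (intro openin_Int openin_diff openin_continuous_map_preimage[OF q]) auto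
    then have "openin X (\<Union>(r, s)\<in>{(r, s). c \<le> ereal (r + s)}.
        (topspace X - {x \<in> topspace X. J x \<le> ereal r}) \<inter> {x \<in> topspace X. q x \<in> {s<..}})" (is "openin X ?U")
      by (intro openin_Union) auto
    moreover have "topspace X - {x \<in> topspace X. J x + ereal (q x) \<le> c} = ?U"
    proof (intro set_eqI iffI)
      fix x assume x: "x \<in> topspace X - {x \<in> topspace X. J x + ereal (q x) \<le> c}"
      then have "c < J x + ereal (q x)" by (auto simp: not_le)
      then obtain d where d: "c < ereal d" "ereal d < J x + ereal (q x)" using ereal_dense2 by blast
      then have "ereal (d - q x) < J x" by (cases "J x") auto
      then obtain r where r: "ereal (d - q x) < ereal r" "ereal r < J x" using ereal_dense2 by blast
      have "c \<le> ereal (r + (d - r))" using d(1) by simp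
      moreover have "d - r < q x" using r(1) by simp
      ultimately show "x \<in> ?U" using x r(2) by (intro UN_I[of "(r, d - r)"]) (auto simp: not_le)
    next
      fix x assume "x \<in> ?U"
      then obtain r s where rs: "c \<le> ereal (r + s)" "x \<in> topspace X" "ereal r < J x" "s < q x"
        by (auto simp: not_le)
      have "ereal (r + s) < J x + ereal (q x)" using rs(3,4) by (cases "J x") auto
      then show "x \<in> topspace X - {x \<in> topspace X. J x + ereal (q x) \<le> c}"
        using rs(1,2) by (auto simp: not_le intro: le_less_trans)
    qed
    ultimately show ?thesis unfolding closedin_def by auto
  qed
  have "compactin X {x \<in> topspace X. J x + ereal (q x) \<le> ereal c}" for c
  proof (rule closed_compactin[OF _ _ cl])
    show "compactin X {x \<in> topspace X. J x \<le> ereal c}"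
      using good by (simp add: good_rate_function_def)
    show "{x \<in> topspace X. J x + ereal (q x) \<le> ereal c} \<subseteq> {x \<in> topspace X. J x \<le> ereal c}"
    proof clarify
      fix x assume x: "x \<in> topspace X" "J x + ereal (q x) \<le> ereal c"
      show "J x \<le> ereal c" using x(2) q0[OF x(1)] by (cases "J x") auto
    qed
  qed
  then show ?thesis
    using cl J0 q0 by (simp add: good_rate_function_def rate_function_def)
qed

text \<open>Fenchel--Moreau without separation theorems: goodness provides a minimiser of the
  Moreau--Yosida regularisation \<open>J + k |x - x0|\<^sup>2 / 2\<close>, where \<open>J\<close> has the subgradient \<open>k (x0 - w)\<close>.\<close>
lemma convex_good_affine_minorant:
  assumes good: "good_rate_function (Rm_topology m) J" and conv: "convex_Rm m J"
    and z: "z \<in> topspace (Rm_topology m)" "J z < \<infinity>"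
    and x0: "x0 \<in> topspace (Rm_topology m)" and c: "ereal c < J x0"
  obtains l where "\<And>x. x \<in> topspace (Rm_topology m) \<Longrightarrow> ereal (c + (\<Sum>i<m. l i * (x i - x0 i))) \<le> J x"
proof -
  define q where "q x = (\<Sum>i<m. (x i - x0 i)\<^sup>2)" for x
  have rate: "rate_function (Rm_topology m) J" using good by (simp add: good_rate_function_def)
  have J0: "0 \<le> J x" if "x \<in> topspace (Rm_topology m)" for x
    using rate that unfolding rate_function_def by blast
  have q0: "0 \<le> q x" for x by (simp add: q_def sum_nonneg)
  have "openin (Rm_topology m) (topspace (Rm_topology m) - {x \<in> topspace (Rm_topology m). J x \<le> ereal c})"
    (is "openin _ ?W")
    using rate unfolding rate_function_def by blast
  moreover have "x0 \<in> ?W" using x0 c by auto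
  ultimately obtain r where r': "r > 0"
    "\<And>x. x \<in> topspace (Rm_topology m) \<Longrightarrow> (\<Sum>i<m. (x i - x0 i)\<^sup>2) < r \<Longrightarrow> x \<in> ?W"
    by (rule Rm_ball_subset) (rule that; blast)
  note r = r'[folded q_def]
  \<comment> \<open>Since \<open>k / 2 * r = \<bar>c\<bar>\<close>, the penalty alone reaches
    \<open>c\<close> where \<open>q \<ge> r\<close>, while \<open>J > c\<close> where
    \<open>q < r\<close>. Hence the regularised minimum is at least \<open>c\<close>, which is
    \<open>cj\<close>.\<close>
  define k where "k = 2 * \<bar>c\<bar> / r"
  have k: "0 \<le> k" "k / 2 * r = \<bar>c\<bar>" using r(1) by (auto simp: k_def)
  have "continuous_map (Rm_topology m) euclideanreal (\<lambda>x. \<Sum>i<m. k / 2 * (x i - x0 i)\<^sup>2)"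
    by (intro continuous_map_Rm_sum continuous_intros)
  then have cont: "continuous_map (Rm_topology m) euclideanreal (\<lambda>x. k / 2 * q x)"
    unfolding q_def by (simp only: sum_distrib_left)
  have "good_rate_function (Rm_topology m) (\<lambda>x. J x + ereal (k / 2 * q x))"
    using k(1) q0 by (intro good_rate_function_add_continuous[OF good cont]) auto
  from good_rate_function_attains_min[OF this z(1)] obtain w where w: "w \<in> topspace (Rm_topology m)"
    "\<And>y. y \<in> topspace (Rm_topology m) \<Longrightarrow> J w + ereal (k / 2 * q w) \<le> J y + ereal (k / 2 * q y)"
    by blast
  have "J w < \<infinity>" using w(2)[OF z(1)] z(2) by (cases "J w"; cases "J z") auto
  then obtain j where j: "J w = ereal j" "0 \<le> j" using J0[OF w(1)] by (cases "J w") auto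
  have cj: "c \<le> j + k / 2 * q w"
  proof (cases "q w < r")
    case True
    then have "\<not> J w \<le> ereal c" using r(2)[OF w(1)] w(1) by blast
    then have "ereal c < J w" by (simp add: not_le)
    then have "c < j" using j by simp
    moreover have "0 \<le> k / 2 * q w" using k(1) q0 by simp
    ultimately show ?thesis by linarith
  next
    case False
    then have "k / 2 * r \<le> k / 2 * q w" using k(1) by (intro mult_left_mono) auto
    then show ?thesis using k(2) j(2) by linarith
  qed
  define l where "l i = k * (x0 i - w i)" for i
  show ?thesis
  proof
    fix x assume x: "x \<in> topspace (Rm_topology m)"
    show "ereal (c + (\<Sum>i<m. l i * (x i - x0 i))) \<le> J x"
    proof (cases "J x = \<infinity>")
      case False
      then obtain y where y: "J x = ereal y" using J0[OF x] by (cases "J x") auto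
      define P D where "P = (\<Sum>i<m. (x0 i - w i) * (x i - w i))" and "D = (\<Sum>i<m. (x i - w i)\<^sup>2)"
      have lP: "(\<Sum>i<m. l i * (x i - w i)) = k * P"
        by (simp add: l_def P_def sum_distrib_left mult.assoc)
      \<comment> \<open>First-order condition at the minimiser \<open>w\<close>: compare with the
        point at parameter \<open>t\<close> on the segment towards \<open>x\<close>, use convexity,
        and divide by \<open>t\<close>.\<close>
      have "0 \<le> (y - j - k * P) + t * (k / 2 * D)"
        if t: "0 < t" "t \<le> 1" for t
      proof -
        define v where "v = restrict (\<lambda>i. t * x i + (1 - t) * w i) {..<m}"
        have v: "v \<in> topspace (Rm_topology m)" by (simp add: v_def)
        have "J v \<le> ereal t * J x + ereal (1 - t) * J w"
          using conv x w(1) t unfolding convex_Rm_def v_def by auto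
        then have Jv: "J v \<le> ereal (t * y + (1 - t) * j)" using y j by simp
        have "ereal (j + k / 2 * q w) \<le> J v + ereal (k / 2 * q v)" using w(2)[OF v] j by simp
        also have "\<dots> \<le> ereal (t * y + (1 - t) * j) + ereal (k / 2 * q v)"
          using Jv by (rule add_right_mono)
        finally have 1: "j + k / 2 * q w \<le> t * y + (1 - t) * j + k / 2 * q v" by simp
        have "q v = (\<Sum>i<m. (t * x i + (1 - t) * w i - x0 i)\<^sup>2)"
          unfolding q_def v_def by (intro sum.cong) auto
        also have "\<dots> = (\<Sum>i<m. (w i - x0 i)\<^sup>2 - 2 * t * ((x0 i - w i) * (x i - w i)) + t\<^sup>2 * (x i - w i)\<^sup>2)"
          by (intro sum.cong refl) (simp add: power2_eq_square algebra_simps)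
        also have "\<dots> = q w - 2 * t * P + t\<^sup>2 * D"
          by (simp add: q_def P_def D_def sum.distrib sum_subtractf sum_distrib_left)
        finally have qv: "q v = q w - 2 * t * P + t\<^sup>2 * D" .
        have "0 \<le> t * ((y - j - k * P) + t * (k / 2 * D))"
          using 1 unfolding qv by (simp add: power2_eq_square field_simps)
        then show ?thesis using t(1) by (simp only: zero_le_mult_iff) auto
      qed
      then have "0 \<le> y - j - (\<Sum>i<m. l i * (x i - w i))"
        unfolding lP by (rule nonneg_of_small_perturbation)
      \<comment> \<open>Moving the base point from \<open>w\<close> to \<open>x0\<close> gains
        \<open>k * q w\<close>, which outweighs the \<open>k / 2 * q w\<close> by which
        \<open>j\<close> may fall below \<open>c\<close> in \<open>cj\<close>.\<close>
      moreover have "(\<Sum>i<m. l i * (x i - w i)) = (\<Sum>i<m. l i * (x i - x0 i)) + k * q w"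
      proof -
        have "(\<Sum>i<m. l i * (x i - w i)) = (\<Sum>i<m. l i * (x i - x0 i) + k * (w i - x0 i)\<^sup>2)"
          by (intro sum.cong refl) (simp add: l_def power2_eq_square algebra_simps)
        then show ?thesis by (simp add: sum.distrib q_def sum_distrib_left)
      qed
      moreover have "0 \<le> k / 2 * q w" using k(1) q0 by simp
      ultimately have "c + (\<Sum>i<m. l i * (x i - x0 i)) \<le> y" using cj by linarith
      then show ?thesis using y by simp
    qed simp
  qed
qed

section \<open>Unique zero and the variational formula\<close>

context vague_ldp
begin

lemma fdvec_topspace: "fdvec m fs \<mu> \<in> topspace (Rm_topology m)"
  by (simp add: fdvec_def)

text \<open>Existence is \<open>ldp_zero\<close> for the vague LDP. At a zero of \<open>I\<close>
  every one-dimensional rate function vanishes, so the integrals of all test functions are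
  determined, and with them the measure.\<close>

lemma I_zero_unique:
  assumes uniq: "\<forall>fs. fs 0 \<in> Cc \<longrightarrow> (\<exists>!x. x \<in> topspace (Rm_topology 1) \<and> J 1 fs x = 0)"
  shows "\<exists>!\<mu>. \<mu> \<in> radon_measures \<and> I \<mu> = 0"
proof -
  obtain \<mu> where \<mu>: "\<mu> \<in> radon_measures" "I \<mu> = 0"
    using ldp_zero[OF ldp_I good_rate_function_I prob] xi_radon unfolding topspace_vague by metis
  show ?thesis
  proof (intro ex1I[of _ \<mu>] conjI \<mu>)
    fix \<nu> assume \<nu>: "\<nu> \<in> radon_measures \<and> I \<nu> = 0"
    show "\<nu> = \<mu>"
    proof (rule radon_measures_eqI[OF lc])
      fix f :: "'a \<Rightarrow> real" assume f: "f \<in> Cc"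
      have tup: "(1, \<lambda>_. f) \<in> test_tuples" using f by (simp add: test_tuples_def)
      have "J 1 (\<lambda>_. f) (fdvec 1 (\<lambda>_. f) \<kappa>) = 0" if "I \<kappa> = 0" for \<kappa>
        using J_le_I[OF tup, of \<kappa>] J_nonneg[OF tup fdvec_topspace[of 1 "\<lambda>_. f" \<kappa>]] that by simp
      then have "fdvec 1 (\<lambda>_. f) \<nu> = fdvec 1 (\<lambda>_. f) \<mu>"
        using uniq[rule_format, of "\<lambda>_. f"] f \<mu> \<nu> fdvec_topspace by blast
      then have "fdvec 1 (\<lambda>_. f) \<nu> 0 = fdvec 1 (\<lambda>_. f) \<mu> 0" by simp
      then show "integral\<^sup>L \<nu> f = integral\<^sup>L \<mu> f" by (simp add: fdvec_def)
    qed (use \<mu> \<nu> in auto)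
  qed
qed

lemma borel_measurable_integral_xi:
  assumes f: "f \<in> Cc"
  shows "(\<lambda>\<omega>. integral\<^sup>L (\<xi> n \<omega>) f) \<in> borel_measurable (M n)"
proof (rule borel_measurableI)
  fix S :: "real set" assume S: "open S"
  have "(\<lambda>\<omega>. integral\<^sup>L (\<xi> n \<omega>) f) -` S \<inter> space (M n) =
      {\<omega> \<in> space (M n). \<xi> n \<omega> \<in> {\<mu> \<in> topspace vague_topology. integral\<^sup>L \<mu> f \<in> S}}"
    using xi_radon by (auto simp: topspace_vague)
  also have "\<dots> \<in> sets (M n)"
    using S by (intro sets_open openin_continuous_map_preimage[OF continuous_map_vague_integral[OF f]]) simp
  finally show "(\<lambda>\<omega>. integral\<^sup>L (\<xi> n \<omega>) f) -` S \<inter> space (M n) \<in> sets (M n)" .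
qed

lemma integral_combination:
  fixes fs :: "nat \<Rightarrow> 'a \<Rightarrow> real"
  assumes "(m, fs) \<in> test_tuples" "\<mu> \<in> radon_measures"
  shows "integral\<^sup>L \<mu> (\<lambda>x. \<Sum>i<m. l i * fs i x) = (\<Sum>i<m. l i * fdvec m fs \<mu> i)"
proof -
  have "integrable \<mu> (fs i)" if "i < m" for i
    using assms that by (intro Cc_integrable) (auto simp: test_tuples_def)
  then show ?thesis
    by (subst Bochner_Integration.integral_sum) (auto simp: fdvec_def)
qed

lemma combination_Cc:
  fixes fs :: "nat \<Rightarrow> 'a \<Rightarrow> real"
  assumes "(m, fs) \<in> test_tuples"
  shows "(\<lambda>x. \<Sum>i<m. l i * fs i x) \<in> Cc"
  using assms by (intro Cc_sum Cc_scale) (auto simp: test_tuples_def)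

text \<open>A linear function of the marginals is the integral of a single test function, so
  Varadhan's lower bound for it is a statement about \<open>scaled_lmgf\<close>.\<close>

lemma scaled_lmgf_lower:
  assumes fs: "(m, fs) \<in> test_tuples" and x: "x \<in> topspace (Rm_topology m)"
  shows "ereal (\<Sum>i<m. l i * x i) - J m fs x \<le> liminf (scaled_lmgf M \<xi> a (\<lambda>x. \<Sum>i<m. l i * fs i x))"
  unfolding scaled_lmgf_def
  by (intro ldp_laplace_lower[OF tuple_ldp(1)[OF fs] a_pos, where F="\<lambda>x. \<Sum>i<m. l i * x i"]
      continuous_map_Rm_sum continuous_intros borel_measurable_integral_xi combination_Cc[OF fs]
      fdvec_topspace integral_combination[OF fs] xi_radon x)

text \<open>The doubled exponential moment demanded by \<open>ldp_laplace_upper\<close> is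
  \<open>fin\<close> at twice the combination, which is again in \<open>Cc\<close>.\<close>

lemma scaled_lmgf_upper:
  assumes fs: "(m, fs) \<in> test_tuples"
    and fin: "\<forall>f\<in>Cc. (SUP n. scaled_lmgf M \<xi> a f n) < \<infinity>"
    and s: "\<And>x. x \<in> topspace (Rm_topology m) \<Longrightarrow> ereal ((\<Sum>i<m. l i * x i) - s) \<le> J m fs x"
  shows "limsup (scaled_lmgf M \<xi> a (\<lambda>x. \<Sum>i<m. l i * fs i x)) \<le> ereal s"
proof -
  let ?g = "\<lambda>x. \<Sum>i<m. l i * fs i x"
  have g: "?g \<in> Cc" by (rule combination_Cc[OF fs])
  have "(SUP n. scaled_lmgf M \<xi> a (\<lambda>x. 2 * ?g x) n) < \<infinity>"
    using fin Cc_scale[OF g, of 2] by blast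
  then obtain B where B: "(SUP n. scaled_lmgf M \<xi> a (\<lambda>x. 2 * ?g x) n) < ereal B"
    using ereal_dense2 by blast
  have "(\<integral>\<^sup>+ \<omega>. ennreal (exp (a n * (2 * integral\<^sup>L (\<xi> n \<omega>) ?g))) \<partial>M n) \<le> ennreal (exp (a n * B))" for n
  proof -
    have "scaled_lmgf M \<xi> a (\<lambda>x. 2 * ?g x) n \<le> ereal B"
      using B by (meson SUP_upper UNIV_I less_imp_le order_trans)
    then show ?thesis unfolding scaled_lmgf_def scaled_eln_le_iff[OF a_pos] by simp
  qed
  then show ?thesis
    unfolding scaled_lmgf_def
    by (intro ldp_laplace_upper[OF tuple_ldp(1)[OF fs] a_pos a_lim prob, where F="\<lambda>x. \<Sum>i<m. l i * x i"]
        continuous_map_Rm_sum continuous_intros borel_measurable_integral_xi g fdvec_topspace s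
        integral_combination[OF fs] xi_radon)
qed

text \<open>Both Laplace bounds meet at \<open>S\<close>, the conjugate of the one-dimensional rate
  function at slope 1. It is finite: \<open>fin\<close> bounds it above, a zero of the rate function
  below.\<close>

lemma scaled_lmgf_convergent:
  assumes fin: "\<forall>f\<in>Cc. (SUP n. scaled_lmgf M \<xi> a f n) < \<infinity>" and f: "f \<in> Cc"
  shows "\<exists>s. scaled_lmgf M \<xi> a f \<longlonglongrightarrow> ereal s"
proof -
  have tup: "(1, \<lambda>_. f) \<in> test_tuples" using f by (simp add: test_tuples_def)
  let ?L = "liminf (scaled_lmgf M \<xi> a f)" and ?U = "limsup (scaled_lmgf M \<xi> a f)"
  define S where "S = (SUP x\<in>topspace (Rm_topology 1). ereal (x 0) - J 1 (\<lambda>_. f) x)"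
  have "ereal (x 0) - J 1 (\<lambda>_. f) x \<le> ?L" if "x \<in> topspace (Rm_topology 1)" for x
    using scaled_lmgf_lower[OF tup that, of "\<lambda>_. 1"] by simp
  then have SL: "S \<le> ?L" unfolding S_def by (intro SUP_least)
  have LU: "?L \<le> ?U" by (rule Liminf_le_Limsup) simp
  have "?U \<le> (SUP n. scaled_lmgf M \<xi> a f n)"
    by (intro Limsup_bounded always_eventually allI SUP_upper) simp
  then have "S < \<infinity>" using SL LU fin f by (meson order_trans le_less_trans)
  moreover have "S > - \<infinity>"
  proof -
    obtain x where x: "x \<in> topspace (Rm_topology 1)" "J 1 (\<lambda>_. f) x = 0"
      using ldp_zero[OF tuple_ldp[OF tup] prob] fdvec_topspace by metis
    have "ereal (x 0) - J 1 (\<lambda>_. f) x \<le> S" unfolding S_def by (rule SUP_upper[OF x(1)])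
    then show ?thesis using x(2) by (cases S) auto
  qed
  ultimately obtain s where s: "S = ereal s" by (cases S) auto
  have "ereal (x 0 - s) \<le> J 1 (\<lambda>_. f) x" if "x \<in> topspace (Rm_topology 1)" for x
  proof -
    have "ereal (x 0) - J 1 (\<lambda>_. f) x \<le> ereal s"
      unfolding s[symmetric] S_def by (rule SUP_upper[OF that])
    then show ?thesis by (cases "J 1 (\<lambda>_. f) x") auto
  qed
  then have "?U \<le> ereal s"
    using scaled_lmgf_upper[OF tup fin, of "\<lambda>_. 1" s] by simp
  then have "?L = ereal s" "?U = ereal s" using SL LU s by auto
  then show ?thesis by (intro exI[of _ s] Liminf_eq_Limsup) auto
qed

text \<open>One inequality is the one-dimensional Laplace lower bound. For the other, an affine
  minorant of \<open>J m fs\<close> with value \<open>c\<close> at \<open>fdvec m fs \<mu>\<close>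
  has as slopes the coefficients of a test function \<open>g\<close>, and the Laplace upper bound
  then reads \<open>c \<le> integral\<^sup>L \<mu> g - \<phi> g\<close>.\<close>

lemma I_eq_conjugate:
  assumes conv: "\<forall>m fs. m \<ge> 1 \<and> (\<forall>i<m. fs i \<in> Cc) \<longrightarrow> convex_Rm m (J m fs)"
    and fin: "\<forall>f\<in>Cc. (SUP n. scaled_lmgf M \<xi> a f n) < \<infinity>"
    and \<phi>: "\<And>f. f \<in> Cc \<Longrightarrow> scaled_lmgf M \<xi> a f \<longlonglongrightarrow> ereal (\<phi> f)"
    and \<mu>: "\<mu> \<in> radon_measures"
  shows "I \<mu> = (SUP f\<in>Cc. ereal (integral\<^sup>L \<mu> f - \<phi> f))"
proof (rule antisym)
  have lim: "liminf (scaled_lmgf M \<xi> a f) = ereal (\<phi> f)" "limsup (scaled_lmgf M \<xi> a f) = ereal (\<phi> f)"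
    if "f \<in> Cc" for f
    using lim_imp_Liminf[OF _ \<phi>[OF that]] lim_imp_Limsup[OF _ \<phi>[OF that]] by auto
  show "(SUP f\<in>Cc. ereal (integral\<^sup>L \<mu> f - \<phi> f)) \<le> I \<mu>"
  proof (rule SUP_least)
    fix f :: "'a \<Rightarrow> real" assume f: "f \<in> Cc"
    have tup: "(1, \<lambda>_. f) \<in> test_tuples" using f by (simp add: test_tuples_def)
    have "ereal (integral\<^sup>L \<mu> f) - J 1 (\<lambda>_. f) (fdvec 1 (\<lambda>_. f) \<mu>) \<le> ereal (\<phi> f)"
      using scaled_lmgf_lower[OF tup fdvec_topspace[of 1 "\<lambda>_. f" \<mu>], of "\<lambda>_. 1"] lim(1)[OF f] by (simp add: fdvec_def)
    then have "ereal (integral\<^sup>L \<mu> f - \<phi> f) \<le> J 1 (\<lambda>_. f) (fdvec 1 (\<lambda>_. f) \<mu>)"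
      by (cases "J 1 (\<lambda>_. f) (fdvec 1 (\<lambda>_. f) \<mu>)") auto
    also have "\<dots> \<le> I \<mu>" by (rule J_le_I[OF tup])
    finally show "ereal (integral\<^sup>L \<mu> f - \<phi> f) \<le> I \<mu>" .
  qed
  show "I \<mu> \<le> (SUP f\<in>Cc. ereal (integral\<^sup>L \<mu> f - \<phi> f))"
    unfolding I_def
  proof (intro SUP_least)
    fix m and fs :: "nat \<Rightarrow> 'a \<Rightarrow> real" assume "m \<in> {1..}" "fs \<in> {fs. \<forall>i<m. fs i \<in> Cc}"
    then have tup: "(m, fs) \<in> test_tuples" and cJ: "convex_Rm m (J m fs)"
      using conv by (auto simp: test_tuples_def)
    let ?x0 = "fdvec m fs \<mu>"
    obtain z where z: "z \<in> topspace (Rm_topology m)" "J m fs z = 0"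
      using ldp_zero[OF tuple_ldp[OF tup] prob] fdvec_topspace by metis
    show "J m fs ?x0 \<le> (SUP f\<in>Cc. ereal (integral\<^sup>L \<mu> f - \<phi> f))"
    proof (rule ccontr)
      assume "\<not> J m fs ?x0 \<le> (SUP f\<in>Cc. ereal (integral\<^sup>L \<mu> f - \<phi> f))"
      then obtain c where c: "(SUP f\<in>Cc. ereal (integral\<^sup>L \<mu> f - \<phi> f)) < ereal c" "ereal c < J m fs ?x0"
        using ereal_dense2 by (auto simp: not_le)
      obtain l where l: "\<And>x. x \<in> topspace (Rm_topology m) \<Longrightarrow>
          ereal (c + (\<Sum>i<m. l i * (x i - ?x0 i))) \<le> J m fs x"
        using convex_good_affine_minorant[OF tuple_ldp(2)[OF tup] cJ z(1) _ fdvec_topspace c(2)] z(2)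
        by auto
      let ?g = "\<lambda>x. \<Sum>i<m. l i * fs i x"
      have g: "?g \<in> Cc" by (rule combination_Cc[OF tup])
      have "limsup (scaled_lmgf M \<xi> a ?g) \<le> ereal ((\<Sum>i<m. l i * ?x0 i) - c)"
      proof (rule scaled_lmgf_upper[OF tup fin])
        fix x assume "x \<in> topspace (Rm_topology m)"
        from l[OF this] show "ereal ((\<Sum>i<m. l i * x i) - ((\<Sum>i<m. l i * ?x0 i) - c)) \<le> J m fs x"
          by (simp add: right_diff_distrib sum_subtractf algebra_simps)
      qed
      then have "c \<le> integral\<^sup>L \<mu> ?g - \<phi> ?g"
        using lim(2)[OF g] integral_combination[OF tup \<mu>, of l] by simp
      also have "ereal \<dots> \<le> (SUP f\<in>Cc. ereal (integral\<^sup>L \<mu> f - \<phi> f))" by (rule SUP_upper[OF g])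
      finally show False using c(1) by simp
    qed
  qed
qed

end

theorem mainTheorem16:
  fixes M :: "nat \<Rightarrow> 'w measure"
    and \<xi> :: "nat \<Rightarrow> 'w \<Rightarrow> 'a::{t2_space, second_countable_topology} measure"
    and a :: "nat \<Rightarrow> real"
    and J :: "nat \<Rightarrow> (nat \<Rightarrow> 'a \<Rightarrow> real) \<Rightarrow> (nat \<Rightarrow> real) \<Rightarrow> ereal"
    and I :: "'a measure \<Rightarrow> ereal"
  assumes lc: "locally_compact_space (euclidean :: 'a topology)"
    and a_pos: "\<And>n. a n > 0"
    and a_lim: "filterlim a at_top sequentially"
    and prob: "\<And>n. prob_space (M n)"
    and meas: "\<And>n. \<xi> n \<in> measurable (M n) (borel_of_top vague_topology)"
    and fd_ldp: "\<And>m fs. m \<ge> 1 \<Longrightarrow> (\<forall>i<m. fs i \<in> Cc) \<Longrightarrow>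
        ldp (Rm_topology m) M (\<lambda>n \<omega>. fdvec m fs (\<xi> n \<omega>)) a (J m fs) \<and>
        good_rate_function (Rm_topology m) (J m fs)"
    and I_def: "\<And>\<mu>. I \<mu> = (SUP m\<in>{1..}. SUP fs\<in>{fs. \<forall>i<m. fs i \<in> Cc}. J m fs (fdvec m fs \<mu>))"
  shows "ldp vague_topology M \<xi> a I \<and> good_rate_function vague_topology I
    \<and> ((\<forall>fs. fs 0 \<in> Cc \<longrightarrow> (\<exists>!x. x \<in> topspace (Rm_topology 1) \<and> J 1 fs x = 0))
         \<longrightarrow> (\<exists>!\<mu>. \<mu> \<in> radon_measures \<and> I \<mu> = 0))
    \<and> (((\<forall>m fs. m \<ge> 1 \<and> (\<forall>i<m. fs i \<in> Cc) \<longrightarrow> convex_Rm m (J m fs))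
          \<and> (\<forall>f\<in>Cc. (SUP n. scaled_lmgf M \<xi> a f n) < \<infinity>))
         \<longrightarrow> (\<exists>\<phi> :: ('a \<Rightarrow> real) \<Rightarrow> real.
                (\<forall>f\<in>Cc. scaled_lmgf M \<xi> a f \<longlonglongrightarrow> ereal (\<phi> f))
              \<and> (\<forall>\<mu>\<in>radon_measures. I \<mu> = (SUP f\<in>Cc. ereal (integral\<^sup>L \<mu> f - \<phi> f)))))"
  proof -
  interpret vague_ldp M \<xi> a J I
    by (rule vague_ldp.intro) (fact lc a_pos a_lim prob meas fd_ldp I_def)+
  have "\<exists>\<phi> :: ('a \<Rightarrow> real) \<Rightarrow> real. (\<forall>f\<in>Cc. scaled_lmgf M \<xi> a f \<longlonglongrightarrow> ereal (\<phi> f))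
      \<and> (\<forall>\<mu>\<in>radon_measures. I \<mu> = (SUP f\<in>Cc. ereal (integral\<^sup>L \<mu> f - \<phi> f)))"
    if conv: "\<forall>m fs. m \<ge> 1 \<and> (\<forall>i<m. fs i \<in> Cc) \<longrightarrow> convex_Rm m (J m fs)"
      and fin: "\<forall>f\<in>Cc. (SUP n. scaled_lmgf M \<xi> a f n) < \<infinity>"
  proof -
    obtain \<phi> where \<phi>: "\<And>f. f \<in> Cc \<Longrightarrow> scaled_lmgf M \<xi> a f \<longlonglongrightarrow> ereal (\<phi> f)"
      using scaled_lmgf_convergent[OF fin] by metis
    then show ?thesis using I_eq_conjugate[OF conv fin \<phi>] by blast
  qed
  then show ?thesis
    using ldp_I good_rate_function_I I_zero_unique by blast
qed

end
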